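(* Let $q\in\mathbb{C}^*$ and let $k\ge 1$. The $q$-rook monoid algebra $R_k(q)$ and the algebra $A_k(q)$ are isomorphic: $R_k(q)\cong A_k(q)$, the generators $T_1,\dots,T_{k-1}$ of $A_k(q)$ corresponding to $T_1,\dots,T_{k-1}\in R_k(q)$ and the generator $X_1$ of $A_k(q)$ corresponding to $1-P_1\in R_k(q)$. Thus the defining presentation of $A_k(q)$ is a presentation of $R_k(q)$ on the generators $X_1=1-P_1,T_1,\dots,T_{k-1}$.
   Context: All algebras are associative unital $\mathbb{C}$-algebras. Fix $q\in\mathbb{C}^*$. The $q$-rook monoid algebra $R_k(q)$ is the algebra given by generators $P_1,\dots,P_k$ and $T_1,\dots,T_{k-1}$ with relations (A1) $T_i^2=(q-q^{-1})T_i+1$ for $1\le i\le k-1$; (A2) $T_iT_{i+1}T_i=T_{i+1}T_iT_{i+1}$ for $1\le i\le k-2$; (A3) $T_iT_j=T_jT_i$ for $|i-j|>1$; (R1) $P_i^2=P_i$ for $1\le i\le k$; (R2) $P_iP_j=P_jP_i$ for $1\le i,j\le k$; (R3) $P_iT_j=T_jP_i$ for $1\le i<j\le k-1$; (R4) $P_iT_j=T_jP_i=qP_i$ for $1\le j<i\le k$; (R5) $P_{i+1}=qP_iT_i^{-1}P_i=q\bigl(P_iT_iP_i-(q-q^{-1})P_i\bigr)$ for $1\le i\le k-1$. The algebra $A_k(q)$ is the algebra given by generators $X_1$ and $T_1,\dots,T_{k-1}$ with relations (A1) $T_i^2=(q-q^{-1})T_i+1$ for $1\le i\le k-1$; (A2)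 $T_iT_{i+1}T_i=T_{i+1}T_iT_{i+1}$ for $1\le i\le k-2$; (A3) $T_iT_j=T_jT_i$ for $|i-j|>1$; (B1) $X_1T_j=T_jX_1$ for $2\le j\le k-1$; (B2) $X_1^2=X_1$; (B3) $X_1T_1X_1T_1=T_1X_1T_1X_1$; (B4) $(1-X_1)(T_1-q)(1-X_1)(1-X_2)=0$, where $X_2=T_1X_1T_1$. Relations involving $T_1$ are omitted when $k=1$. *)

theory Defs
  imports Complex_Main "HOL-Library.Poly_Mapping" "HOL-Algebra.QuotRing" "HOL-Algebra.Module"
begin

section \<open>Complex algebras given by generators and relations\<close>

text \<open>
  Lists under concatenation form the free monoid, so that the convolution product on
  finitely supported functions from lists to complex numbers is the product of the
  free (noncommutative) associative unital algebra.
\<close>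

instantiation list :: (type) monoid_add
begin
definition zero_list :: "'a list" where "zero_list = []"
definition plus_list :: "'a list \<Rightarrow> 'a list \<Rightarrow> 'a list" where "plus_list xs ys = xs @ ys"
instance by standard (simp_all add: zero_list_def plus_list_def)
end

type_synonym 'g free = "'g list \<Rightarrow>\<^sub>0 complex"

definition gen :: "'g \<Rightarrow> 'g free" where
  "gen g = Poly_Mapping.single [g] 1"

definition const :: "complex \<Rightarrow> 'g free" where
  "const c = Poly_Mapping.single [] c"

definition free_algebra :: "'g set \<Rightarrow> (complex, 'g free) module" where
  "free_algebra G =
     \<lparr>carrier = {f. Poly_Mapping.keys f \<subseteq> lists G}, mult = (*), one = 1,
      zero = 0, add = (+), smult = (\<lambda>c f. const c * f)\<rparr>"

text \<open>
  The scalar multiplication on cosets follows the pattern of \<^const>\<open>rcoset_mult\<close>.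
\<close>

definition quot_algebra :: "(complex, 'a) module \<Rightarrow> 'a set \<Rightarrow> (complex, 'a set) module" where
  "quot_algebra A I =
     \<lparr>carrier = carrier (A Quot I), mult = mult (A Quot I), one = one (A Quot I),
      zero = zero (A Quot I), add = add (A Quot I),
      smult = (\<lambda>c C. \<Union>x\<in>C. I +>\<^bsub>A\<^esub> (c \<odot>\<^bsub>A\<^esub> x))\<rparr>"

text \<open>
  A set \<open>E\<close> of pairs stands for the relations \<open>l = r\<close> with \<open>(l, r) \<in> E\<close>. In HOL-Algebra,
  \<^const>\<open>genideal\<close> is the two-sided ideal generated by a set.
\<close>

definition rel_ideal :: "'g set \<Rightarrow> ('g free \<times> 'g free) set \<Rightarrow> 'g free set" where
  "rel_ideal G E = Idl\<^bsub>free_algebra G\<^esub> {l - r | l r. (l, r) \<in> E}"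

definition presented_algebra ::
    "'g set \<Rightarrow> ('g free \<times> 'g free) set \<Rightarrow> (complex, 'g free set) module" where
  "presented_algebra G E = quot_algebra (free_algebra G) (rel_ideal G E)"

definition presented_class ::
    "'g set \<Rightarrow> ('g free \<times> 'g free) set \<Rightarrow> 'g free \<Rightarrow> 'g free set" where
  "presented_class G E f = rel_ideal G E +>\<^bsub>free_algebra G\<^esub> f"

definition alg_hom :: "(complex, 'a) module \<Rightarrow> (complex, 'b) module \<Rightarrow> ('a \<Rightarrow> 'b) set" where
  "alg_hom A B = {h \<in> ring_hom A B. \<forall>c. \<forall>x\<in>carrier A. h (c \<odot>\<^bsub>A\<^esub> x) = c \<odot>\<^bsub>B\<^esub> h x}"

definition alg_iso :: "(complex, 'a) module \<Rightarrow> (complex, 'b) module \<Rightarrow> ('a \<Rightarrow> 'b) set" where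
  "alg_iso A B = {h \<in> alg_hom A B. bij_betw h (carrier A) (carrier B)}"

text \<open>
  \<open>(G, E)\<close> is a presentation of \<open>B\<close> on the elements \<open>x g\<close>, \<open>g \<in> G\<close>: these generate \<open>B\<close>,
  and the ideal of all relations between them is generated by \<open>E\<close>.
\<close>

definition is_presentation ::
    "'g set \<Rightarrow> ('g free \<times> 'g free) set \<Rightarrow> (complex, 'b) module \<Rightarrow> ('g \<Rightarrow> 'b) \<Rightarrow> bool" where
  "is_presentation G E B x \<longleftrightarrow>
     (\<exists>h\<in>alg_hom (free_algebra G) B.
        (\<forall>g\<in>G. h (gen g) = x g) \<and>
        h ` carrier (free_algebra G) = carrier B \<and>
        a_kernel (free_algebra G) B h = rel_ideal G E)"


section \<open>The two presentations\<close>

definition hecke_rels :: "nat \<Rightarrow> complex \<Rightarrow> (nat \<Rightarrow> 'g free) \<Rightarrow> ('g free \<times> 'g free) set" where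
  "hecke_rels k q T =
     {(T i * T i, const (q - inverse q) * T i + 1) | i. 1 \<le> i \<and> i < k} \<union>
     {(T i * T (i+1) * T i, T (i+1) * T i * T (i+1)) | i. 1 \<le> i \<and> i + 1 < k} \<union>
     {(T i * T j, T j * T i) | i j.
        1 \<le> i \<and> i < k \<and> 1 \<le> j \<and> j < k \<and> \<bar>int i - int j\<bar> > 1}"

datatype rook_gen = RookP nat | RookT nat

definition rook_gens :: "nat \<Rightarrow> rook_gen set" where
  "rook_gens k = RookP ` {1..k} \<union> RookT ` {1..<k}"

text \<open>
  By the quadratic relation, \<open>T\<^sub>i\<close> is invertible with inverse \<open>T\<^sub>i - (q - q\<inverse>)\<close> in the
  presented algebra (see \<open>rook_T_inverse\<close> below); this expresses \<open>T\<^sub>i\<inverse>\<close> in the free algebra.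
\<close>

definition rook_Tinv :: "complex \<Rightarrow> nat \<Rightarrow> rook_gen free" where
  "rook_Tinv q i = gen (RookT i) - const (q - inverse q)"

definition rook_rels :: "nat \<Rightarrow> complex \<Rightarrow> (rook_gen free \<times> rook_gen free) set" where
  "rook_rels k q = (let P = (\<lambda>i. gen (RookP i)); T = (\<lambda>i. gen (RookT i)) in
     hecke_rels k q T \<union>
     {(P i * P i, P i) | i. 1 \<le> i \<and> i \<le> k} \<union>
     {(P i * P j, P j * P i) | i j. 1 \<le> i \<and> i \<le> k \<and> 1 \<le> j \<and> j \<le> k} \<union>
     {(P i * T j, T j * P i) | i j. 1 \<le> i \<and> i < j \<and> j < k} \<union>
     {(P i * T j, T j * P i) | i j. 1 \<le> j \<and> j < i \<and> i \<le> k} \<union>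
     {(T j * P i, const q * P i) | i j. 1 \<le> j \<and> j < i \<and> i \<le> k} \<union>
     {(P (i+1), const q * P i * rook_Tinv q i * P i) | i. 1 \<le> i \<and> i < k} \<union>
     {(P (i+1), const q * (P i * T i * P i - const (q - inverse q) * P i)) | i. 1 \<le> i \<and> i < k})"

datatype A_gen = AX | AT nat

definition A_gens :: "nat \<Rightarrow> A_gen set" where
  "A_gens k = insert AX (AT ` {1..<k})"

definition A_rels :: "nat \<Rightarrow> complex \<Rightarrow> (A_gen free \<times> A_gen free) set" where
  "A_rels k q = (let X = gen AX; T = (\<lambda>i. gen (AT i)); X2 = T 1 * X * T 1 in
     hecke_rels k q T \<union>
     {(X * T j, T j * X) | j. 2 \<le> j \<and> j < k} \<union>
     {(X * X, X)} \<union>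
     (if 2 \<le> k then
       {(X * T 1 * X * T 1, T 1 * X * T 1 * X),
        ((1 - X) * (T 1 - const q) * (1 - X) * (1 - X2), 0)}
      else {}))"

definition rook_algebra :: "nat \<Rightarrow> complex \<Rightarrow> (complex, rook_gen free set) module" where
  "rook_algebra k q = presented_algebra (rook_gens k) (rook_rels k q)"

definition rook_P :: "nat \<Rightarrow> complex \<Rightarrow> nat \<Rightarrow> rook_gen free set" where
  "rook_P k q i = presented_class (rook_gens k) (rook_rels k q) (gen (RookP i))"

definition rook_T :: "nat \<Rightarrow> complex \<Rightarrow> nat \<Rightarrow> rook_gen free set" where
  "rook_T k q i = presented_class (rook_gens k) (rook_rels k q) (gen (RookT i))"

definition A_algebra :: "nat \<Rightarrow> complex \<Rightarrow> (complex, A_gen free set) module" where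
  "A_algebra k q = presented_algebra (A_gens k) (A_rels k q)"

definition A_X1 :: "nat \<Rightarrow> complex \<Rightarrow> A_gen free set" where
  "A_X1 k q = presented_class (A_gens k) (A_rels k q) (gen AX)"

definition A_T :: "nat \<Rightarrow> complex \<Rightarrow> nat \<Rightarrow> A_gen free set" where
  "A_T k q i = presented_class (A_gens k) (A_rels k q) (gen (AT i))"


section \<open>Well-definedness\<close>

lemma free_algebra_simps [simp]:
  "mult (free_algebra G) = (*)" "one (free_algebra G) = 1" "zero (free_algebra G) = 0"
  "add (free_algebra G) = (+)" "smult (free_algebra G) = (\<lambda>c f. const c * f)"
  by (simp_all add: free_algebra_def)

lemma free_carrier_iff: "f \<in> carrier (free_algebra G) \<longleftrightarrow> Poly_Mapping.keys f \<subseteq> lists G"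
  by (simp add: free_algebra_def)

lemma const_closed [simp]: "const c \<in> carrier (free_algebra G)"
  by (auto simp: free_carrier_iff const_def)

lemma const_0 [simp]: "const 0 = 0"
  by (simp add: const_def)

lemma const_1 [simp]: "const 1 = 1"
  by (simp add: const_def zero_list_def[symmetric])

lemma const_mult: "const (a * b) = const a * const b"
  by (simp add: const_def mult_single zero_list_def[symmetric])

lemma const_add: "const (a + b) = const a + const b"
  by (simp add: const_def single_add)

lemma gen_closed: "g \<in> G \<Longrightarrow> gen g \<in> carrier (free_algebra G)"
  by (auto simp: free_carrier_iff gen_def)

lemma one_closed [simp]: "1 \<in> carrier (free_algebra G)"
  by (metis const_1 const_closed)

lemma free_zero_closed [simp]: "0 \<in> carrier (free_algebra G)"
  by (simp add: free_carrier_iff)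

lemma free_add_closed:
  "f \<in> carrier (free_algebra G) \<Longrightarrow> g \<in> carrier (free_algebra G) \<Longrightarrow> f + g \<in> carrier (free_algebra G)"
  using keys_add[of f g] by (auto simp: free_carrier_iff)

lemma free_minus_closed:
  "f \<in> carrier (free_algebra G) \<Longrightarrow> g \<in> carrier (free_algebra G) \<Longrightarrow> f - g \<in> carrier (free_algebra G)"
  using keys_diff[of f g] by (auto simp: free_carrier_iff)

lemma free_mult_closed:
  "f \<in> carrier (free_algebra G) \<Longrightarrow> g \<in> carrier (free_algebra G) \<Longrightarrow> f * g \<in> carrier (free_algebra G)"
  using keys_mult[of f g] by (fastforce simp: free_carrier_iff plus_list_def)

lemmas free_closed =
  gen_closed free_add_closed free_minus_closed free_mult_closed

lemma const_comm: "const c * f = f * const c"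
proof (induction f rule: update_induct)
  case const
  show ?case by simp
next
  case (update f a b)
  have "Poly_Mapping.update a b f = f + Poly_Mapping.single a b"
    using update.hyps
    by (intro poly_mapping_eqI) (auto simp: lookup_add lookup_update lookup_single in_keys_iff when_def)
  then show ?case
    using update.IH
    by (simp add: algebra_simps const_def mult_single zero_list_def[symmetric])
qed

lemma ring_free_algebra: "ring (free_algebra G)"
proof (rule ringI)
  show "abelian_group (free_algebra G)"
  proof (rule abelian_groupI)
    fix x assume "x \<in> carrier (free_algebra G)"
    then show "\<exists>y\<in>carrier (free_algebra G). y \<oplus>\<^bsub>free_algebra G\<^esub> x = \<zero>\<^bsub>free_algebra G\<^esub>"
      by (intro bexI[of _ "0 - x"]) (auto simp del: diff_0 intro: free_closed simp: diff_add_cancel)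
  qed (auto simp: algebra_simps intro: free_closed)
  show "Group.monoid (free_algebra G)"
    by (rule monoidI) (auto simp: algebra_simps intro: free_closed)
qed (auto simp: algebra_simps)

definition wf_rels :: "'g set \<Rightarrow> ('g free \<times> 'g free) set \<Rightarrow> bool" where
  "wf_rels G E \<longleftrightarrow> E \<subseteq> carrier (free_algebra G) \<times> carrier (free_algebra G)"

lemma rel_ideal_ideal:
  assumes "wf_rels G E"
  shows "ideal (rel_ideal G E) (free_algebra G)"
  unfolding rel_ideal_def
  using assms by (intro ring.genideal_ideal ring_free_algebra) (auto simp: wf_rels_def intro: free_closed)

lemma rel_in_ideal:
  assumes "wf_rels G E" "(l, r) \<in> E"
  shows "l - r \<in> rel_ideal G E"
proof -
  have "{l - r | l r. (l, r) \<in> E} \<subseteq> rel_ideal G E"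
    unfolding rel_ideal_def
    using assms by (intro ring.genideal_self ring_free_algebra) (auto simp: wf_rels_def intro: free_closed)
  then show ?thesis using assms(2) by blast
qed

lemma ring_presented_algebra:
  assumes "wf_rels G E"
  shows "ring (presented_algebra G E)"
proof -
  let ?Q = "free_algebra G Quot rel_ideal G E"
  let ?A = "presented_algebra G E"
  interpret Q: ring ?Q
    by (rule ideal.quotient_is_ring[OF rel_ideal_ideal[OF assms]])
  have [simp]: "carrier ?A = carrier ?Q" "mult ?A = mult ?Q" "one ?A = one ?Q"
      "zero ?A = zero ?Q" "add ?A = add ?Q"
    by (simp_all add: presented_algebra_def quot_algebra_def)
  show ?thesis
  proof (rule ringI)
    show "abelian_group ?A"
    proof (rule abelian_groupI)
      fix x assume "x \<in> carrier ?A"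
      then show "\<exists>y\<in>carrier ?A. y \<oplus>\<^bsub>?A\<^esub> x = \<zero>\<^bsub>?A\<^esub>"
        by (intro bexI[of _ "\<ominus>\<^bsub>?Q\<^esub> x"]) (auto simp: Q.l_neg)
    qed (simp_all add: Q.a_assoc, simp add: Q.a_comm)
    show "Group.monoid ?A"
      by (rule monoidI) (auto simp: Q.m_assoc)
  qed (auto simp: Q.l_distr Q.r_distr)
qed

lemma presented_class_eq_iff:
  assumes "wf_rels G E" "f \<in> carrier (free_algebra G)" "g \<in> carrier (free_algebra G)"
  shows "presented_class G E f = presented_class G E g \<longleftrightarrow> f - g \<in> rel_ideal G E"
proof -
  interpret ideal "rel_ideal G E" "free_algebra G"
    by (rule rel_ideal_ideal[OF assms(1)])
  have neg: "\<ominus>\<^bsub>free_algebra G\<^esub> g = - g"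
    by (rule minus_equality) (use assms free_closed(3)[of 0 G g] in auto)
  have "f \<ominus>\<^bsub>free_algebra G\<^esub> g = f - g"
    by (simp add: a_minus_def neg)
  then show ?thesis
    unfolding presented_class_def
    using quotient_eq_iff_same_a_r_cos[OF is_ideal assms(2,3)] by simp
qed

lemma presented_class_mult:
  assumes "wf_rels G E" "f \<in> carrier (free_algebra G)" "g \<in> carrier (free_algebra G)"
  shows "presented_class G E f \<otimes>\<^bsub>presented_algebra G E\<^esub> presented_class G E g =
    presented_class G E (f * g)"
  using ideal.rcoset_mult_add[OF rel_ideal_ideal[OF assms(1)] assms(2,3)]
  by (simp add: presented_class_def presented_algebra_def quot_algebra_def FactRing_def)

lemma presented_class_smult:
  assumes "wf_rels G E" "f \<in> carrier (free_algebra G)"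
  shows "c \<odot>\<^bsub>presented_algebra G E\<^esub> presented_class G E f = presented_class G E (const c * f)"
proof -
  interpret ideal "rel_ideal G E" "free_algebra G"
    by (rule rel_ideal_ideal[OF assms(1)])
  have *: "presented_class G E (const c * x) = presented_class G E (const c * f)"
    if x: "x \<in> presented_class G E f" for x
  proof -
    obtain i where i: "i \<in> rel_ideal G E" "x = i + f"
      using x by (auto simp: presented_class_def a_r_coset_def')
    have "x \<in> carrier (free_algebra G)"
      using i assms(2) by (auto intro: free_closed)
    moreover have "const c * i \<in> rel_ideal G E"
      using I_l_closed[OF i(1), of "const c"] by simp
    moreover have "const c * x - const c * f = const c * i"
      by (simp add: i distrib_left)
    ultimately show ?thesis
      using assms by (simp add: presented_class_eq_iff free_mult_closed)
  qed
  have "f \<in> presented_class G E f"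
    using a_rcos_self[OF assms(2)] by (simp add: presented_class_def)
  then have "(\<Union>x\<in>presented_class G E f. presented_class G E (const c * x)) =
      presented_class G E (const c * f)"
    using * by blast
  then show ?thesis
    unfolding presented_class_def by (simp add: presented_algebra_def quot_algebra_def)
qed

lemma rook_T_gens: "1 \<le> i \<Longrightarrow> i < k \<Longrightarrow> RookT i \<in> rook_gens k"
  by (auto simp: rook_gens_def)

lemma wf_rook_rels: "wf_rels (rook_gens k) (rook_rels k q)"
  unfolding wf_rels_def rook_rels_def hecke_rels_def rook_Tinv_def Let_def
  by (auto intro!: free_closed simp: rook_gens_def)

lemma wf_A_rels: "wf_rels (A_gens k) (A_rels k q)"
  unfolding wf_rels_def A_rels_def hecke_rels_def Let_def
  by (auto intro!: free_closed simp: A_gens_def)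

lemma rook_T_inverse:
  fixes q :: complex
  assumes "1 \<le> i" "i < k"
  defines "S \<equiv> presented_class (rook_gens k) (rook_rels k q) (rook_Tinv q i)"
  shows "rook_T k q i \<otimes>\<^bsub>rook_algebra k q\<^esub> S = \<one>\<^bsub>rook_algebra k q\<^esub>"
    and "S \<otimes>\<^bsub>rook_algebra k q\<^esub> rook_T k q i = \<one>\<^bsub>rook_algebra k q\<^esub>"
proof -
  let ?T = "gen (RookT i)"
  have T: "?T \<in> carrier (free_algebra (rook_gens k))"
    by (intro gen_closed rook_T_gens assms)
  then have Ti: "rook_Tinv q i \<in> carrier (free_algebra (rook_gens k))"
    by (auto simp: rook_Tinv_def intro: free_closed)
  have "(?T * ?T, const (q - inverse q) * ?T + 1) \<in> rook_rels k q"
    using assms(1,2) by (auto simp: rook_rels_def hecke_rels_def Let_def)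
  from rel_in_ideal[OF wf_rook_rels this]
  have *: "?T * ?T - (const (q - inverse q) * ?T + 1) \<in> rel_ideal (rook_gens k) (rook_rels k q)" .
  have one: "presented_class (rook_gens k) (rook_rels k q) 1 = \<one>\<^bsub>rook_algebra k q\<^esub>"
    by (simp add: rook_algebra_def presented_algebra_def quot_algebra_def FactRing_def presented_class_def)
  have eq: "?T * rook_Tinv q i - 1 = ?T * ?T - (const (q - inverse q) * ?T + 1)"
    by (simp add: rook_Tinv_def algebra_simps const_comm)
  from * T Ti
  have "presented_class (rook_gens k) (rook_rels k q) (?T * rook_Tinv q i) =
      presented_class (rook_gens k) (rook_rels k q) 1"
    by (subst presented_class_eq_iff[OF wf_rook_rels]) (auto simp only: eq intro: free_closed one_closed)
  with T Ti show "rook_T k q i \<otimes>\<^bsub>rook_algebra k q\<^esub> S = \<one>\<^bsub>rook_algebra k q\<^esub>"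
    unfolding rook_T_def S_def rook_algebra_def
    by (simp add: presented_class_mult[OF wf_rook_rels] one[unfolded rook_algebra_def])
  have eq: "rook_Tinv q i * ?T - 1 = ?T * ?T - (const (q - inverse q) * ?T + 1)"
    by (simp add: rook_Tinv_def algebra_simps)
  from * T Ti
  have "presented_class (rook_gens k) (rook_rels k q) (rook_Tinv q i * ?T) =
      presented_class (rook_gens k) (rook_rels k q) 1"
    by (subst presented_class_eq_iff[OF wf_rook_rels]) (auto simp only: eq intro: free_closed one_closed)
  with T Ti show "S \<otimes>\<^bsub>rook_algebra k q\<^esub> rook_T k q i = \<one>\<^bsub>rook_algebra k q\<^esub>"
    unfolding rook_T_def S_def rook_algebra_def
    by (simp add: presented_class_mult[OF wf_rook_rels] one[unfolded rook_algebra_def])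
qed

end

theory Submission
  imports Defs
begin

text \<open>
  Relation (R5) expresses every \<open>P\<^sub>i\<^sub>+\<^sub>1\<close> through \<open>P\<^sub>i\<close> and \<open>T\<^sub>i\<close>, so the rook algebra is
  generated by \<open>P\<^sub>1, T\<^sub>1, \<dots>, T\<^sub>k\<^sub>-\<^sub>1\<close>, and the question is which relations between these
  imply all others. Write \<open>z = q - q\<inverse>\<close>, \<open>X = 1 - P\<^sub>1\<close> and \<open>P\<^sub>2 = q(P\<^sub>1T\<^sub>1P\<^sub>1 - zP\<^sub>1)\<close>.

  The substitution \<open>X = 1 - P\<^sub>1\<close> turns (B3) and (B4) into statements about \<open>P\<^sub>2\<close>: (B3) says
  exactly that \<open>P\<^sub>2\<close> commutes with \<open>T\<^sub>1\<close> (\<open>complement_braid_iff_commute\<close>), and in the presence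
  of this, (B4) says exactly that \<open>P\<^sub>2T\<^sub>1 = qP\<^sub>2\<close> (\<open>quartic_iff_eigen\<close>). Being equivalences,
  these two facts serve both for the map from \<open>A\<^sub>k\<close> to \<open>R\<^sub>k\<close> and for its inverse.

  For the inverse, define \<open>P\<^sub>1 = 1 - X\<close> and \<open>P\<^sub>i\<^sub>+\<^sub>1 = qP\<^sub>iT\<^sub>i\<inverse>P\<^sub>i\<close> in \<open>A\<^sub>k\<close>. Absorption
  \<open>P\<^sub>iP\<^sub>j = P\<^sub>j = P\<^sub>jP\<^sub>i\<close> for \<open>i \<le> j\<close> is visible from the shape of the definition and gives
  (R2). Most of the other relations pass from \<open>P\<^sub>i\<close> to \<open>P\<^sub>i\<^sub>+\<^sub>1\<close> at once; the one new fact at each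
  level is \<open>T\<^sub>iP\<^sub>i\<^sub>+\<^sub>1 = P\<^sub>i\<^sub>+\<^sub>1T\<^sub>i = qP\<^sub>i\<^sub>+\<^sub>1\<close>. For \<open>i = 1\<close> it is (B3) and (B4). For \<open>i \<ge> 2\<close> the
  braid relation suffices (\<open>next_idem_top_eigen\<close>): since \<open>P\<^sub>i\<^sub>-\<^sub>1\<close> commutes with \<open>T\<^sub>i\<close>,
  \<open>P\<^sub>i\<^sub>+\<^sub>1 = q\<^sup>2P\<^sub>i\<^sub>-\<^sub>1T\<^sub>i\<^sub>-\<^sub>1\<inverse>T\<^sub>i\<inverse>P\<^sub>i\<close>,
  and \<open>T\<^sub>i\<close> moves through \<open>P\<^sub>i\<^sub>-\<^sub>1\<close> and then through \<open>T\<^sub>i\<^sub>-\<^sub>1\<inverse>T\<^sub>i\<inverse>\<close>, which turns it into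
  \<open>T\<^sub>i\<^sub>-\<^sub>1\<close>, and \<open>T\<^sub>i\<^sub>-\<^sub>1P\<^sub>i = qP\<^sub>i\<close>.

  Both maps are substitutions between free algebras that respect the relations and are
  mutually inverse modulo them. This yields the presentation
  (\<open>is_presentation_substitution\<close>), and a presentation yields the isomorphism
  (\<open>is_presentation_imp_iso\<close>).
\<close>


section \<open>Substitution homomorphisms of free algebras\<close>

definition lift :: "('g \<Rightarrow> 'h free) \<Rightarrow> 'g free \<Rightarrow> 'h free" where
  "lift s f = (\<Sum>w\<in>Poly_Mapping.keys f. const (Poly_Mapping.lookup f w) * prod_list (map s w))"

lemma update_eq_add_single:
  assumes "a \<notin> Poly_Mapping.keys f"
  shows "Poly_Mapping.update a b f = f + Poly_Mapping.single a b"
  using assms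
  by (intro poly_mapping_eqI) (auto simp: lookup_add lookup_update lookup_single in_keys_iff when_def)

lemma free_induct [case_names zero single add]:
  fixes f :: "'g free"
  assumes "P 0" "\<And>w c. P (Poly_Mapping.single w c)" "\<And>f g. P f \<Longrightarrow> P g \<Longrightarrow> P (f + g)"
  shows "P f"
proof (induction f rule: update_induct)
  case (update f a b)
  then show ?case using assms by (simp add: update_eq_add_single)
qed (rule assms(1))

lemma lift_superset:
  assumes "finite A" "Poly_Mapping.keys f \<subseteq> A"
  shows "lift s f = (\<Sum>w\<in>A. const (Poly_Mapping.lookup f w) * prod_list (map s w))"
  unfolding lift_def using assms
  by (intro sum.mono_neutral_left) (auto simp: in_keys_iff)

lemma lift_add: "lift s (f + g) = lift s f + lift s g"
proof -
  let ?A = "Poly_Mapping.keys f \<union> Poly_Mapping.keys g"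
  show ?thesis
    using keys_add[of f g]
    by (simp add: lift_superset[of ?A] lookup_add const_add distrib_right sum.distrib)
qed

lemma lift_single: "lift s (Poly_Mapping.single w c) = const c * prod_list (map s w)"
  by (simp add: lift_superset[of "{w}"])

lemma lift_const [simp]: "lift s (const c) = const c"
  using lift_single[of s "[]" c] by (simp add: const_def)

lemma lift_0 [simp]: "lift s 0 = 0"
  by (simp add: lift_def)

lemma lift_1 [simp]: "lift s 1 = 1"
  by (metis const_1 lift_const)

lemma lift_gen [simp]: "lift s (gen g) = s g"
  using lift_single[of s "[g]" 1] by (simp add: gen_def)

lemma lift_mult: "lift s (f * g) = lift s f * lift s g"
proof (induction f rule: free_induct)
  case (single v c)
  show ?case
  proof (induction g rule: free_induct)
    case (single w d)
    have "const (c * d) * (prod_list (map s v) * prod_list (map s w)) =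
        const c * (const d * prod_list (map s v)) * prod_list (map s w)"
      by (simp add: const_mult mult.assoc)
    also have "\<dots> = const c * prod_list (map s v) * (const d * prod_list (map s w))"
      by (simp add: const_comm[of d "prod_list (map s v)"] mult.assoc)
    finally show ?case
      by (simp add: mult_single lift_single plus_list_def)
  qed (simp_all add: lift_add distrib_left)
qed (simp_all add: lift_add distrib_right)

lemma lift_diff: "lift s (f - g) = lift s f - lift s g"
  using lift_add[of s "f - g" g] by simp

lemmas lift_hom = lift_add lift_diff lift_mult

lemma lift_closed:
  assumes "f \<in> carrier (free_algebra G)" "\<And>g. g \<in> G \<Longrightarrow> s g \<in> carrier (free_algebra H)"
  shows "lift s f \<in> carrier (free_algebra H)"
proof -
  have word: "prod_list (map s w) \<in> carrier (free_algebra H)" if "w \<in> lists G" for w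
    using that by (induction w) (auto intro!: free_mult_closed assms(2))
  have "(\<Sum>w\<in>A. const (Poly_Mapping.lookup f w) * prod_list (map s w)) \<in> carrier (free_algebra H)"
    if "A \<subseteq> lists G" for A
    using that by (induction A rule: infinite_finite_induct)
      (auto intro!: free_add_closed free_mult_closed word)
  then show ?thesis
    using assms(1) by (simp add: lift_def free_carrier_iff)
qed

lemma free_algebra_induct [consumes 1, case_names const gen add mult]:
  assumes "f \<in> carrier (free_algebra G)"
    and const: "\<And>c. P (const c)" and gen: "\<And>g. g \<in> G \<Longrightarrow> P (gen g)"
    and add: "\<And>f g. P f \<Longrightarrow> P g \<Longrightarrow> P (f + g)"
    and mult: "\<And>f g. P f \<Longrightarrow> P g \<Longrightarrow> P (f * g)"
  shows "P f"
proof -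
  have word: "P (Poly_Mapping.single w 1)" if "w \<in> lists G" for w
    using that
  proof (induction w)
    case Nil
    show ?case using const[of 1] unfolding const_def by simp
  next
    case (Cons g w)
    have "Poly_Mapping.single (g # w) 1 = gen g * Poly_Mapping.single w (1 :: complex)"
      by (simp add: gen_def mult_single plus_list_def)
    then show ?case using Cons gen mult by simp
  qed
  have monom: "P (Poly_Mapping.single w c)" if "w \<in> lists G" for w c
  proof -
    have "Poly_Mapping.single w c = const c * Poly_Mapping.single w 1"
      by (simp add: const_def mult_single plus_list_def)
    then show ?thesis using word[OF that] const mult by simp
  qed
  have "Poly_Mapping.keys f \<subseteq> lists G"
    using assms(1) by (simp add: free_carrier_iff)
  then show ?thesis
  proof (induction f rule: update_induct)
    case const
    show ?case using assms(2)[of 0] by simp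
  next
    case (update f a b)
    have "a \<in> lists G" "Poly_Mapping.keys f \<subseteq> lists G"
      using update.prems update.hyps by (auto simp: keys_update)
    then show ?case
      using update.IH update.hyps monom add by (simp add: update_eq_add_single)
  qed
qed


section \<open>Computing modulo a two-sided ideal\<close>

text \<open>
  The ideal lives in a whole type, not in a carrier, so that congruence modulo it is a
  congruence for the type's own ring operations and computations need no membership
  conditions. \<open>extended_ideal\<close> below provides such an ideal for every presentation.
\<close>

locale two_sided_ideal =
  fixes J :: "'a::ring_1 set"
  assumes zero_mem: "0 \<in> J"
    and add_mem: "x \<in> J \<Longrightarrow> y \<in> J \<Longrightarrow> x + y \<in> J"
    and mult_mem_left: "x \<in> J \<Longrightarrow> a * x \<in> J"
    and mult_mem_right: "x \<in> J \<Longrightarrow> x * a \<in> J"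
begin

definition eqv :: "'a \<Rightarrow> 'a \<Rightarrow> bool"  (infix "\<approx>" 50) where
  "x \<approx> y \<longleftrightarrow> x - y \<in> J"

lemma minus_mem: "x \<in> J \<Longrightarrow> - x \<in> J"
  using mult_mem_left[of x "- 1"] by simp

lemma diff_mem: "x \<in> J \<Longrightarrow> y \<in> J \<Longrightarrow> x - y \<in> J"
  using add_mem[OF _ minus_mem, of x y] by simp

lemma eqv_refl [simp, intro]: "x \<approx> x"
  by (simp add: eqv_def zero_mem)

lemma eqv_sym [sym]: "x \<approx> y \<Longrightarrow> y \<approx> x"
  using minus_mem[of "x - y"] by (simp add: eqv_def)

lemma eqv_trans [trans]: "x \<approx> y \<Longrightarrow> y \<approx> z \<Longrightarrow> x \<approx> z"
  using add_mem[of "x - y" "y - z"] by (simp add: eqv_def)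

lemma eqv_add: "x \<approx> x' \<Longrightarrow> y \<approx> y' \<Longrightarrow> x + y \<approx> x' + y'"
  using add_mem[of "x - x'" "y - y'"] by (simp add: eqv_def algebra_simps)

lemma eqv_diff: "x \<approx> x' \<Longrightarrow> y \<approx> y' \<Longrightarrow> x - y \<approx> x' - y'"
  using diff_mem[of "x - x'" "y - y'"] by (simp add: eqv_def algebra_simps)

lemma eqv_left: "x \<approx> y \<Longrightarrow> a * x \<approx> a * y"
  using mult_mem_left[of "x - y" a] by (simp add: eqv_def algebra_simps)

lemma eqv_right: "x \<approx> y \<Longrightarrow> x * a \<approx> y * a"
  using mult_mem_right[of "x - y" a] by (simp add: eqv_def algebra_simps)

lemma eqv_mult: "x \<approx> x' \<Longrightarrow> y \<approx> y' \<Longrightarrow> x * y \<approx> x' * y'"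
  by (rule eqv_trans[OF eqv_left eqv_right])

end


section \<open>Idempotents and Hecke generators\<close>

text \<open>
  The scalars enter only as central elements of the ring; \<open>qi\<close> is the inverse of \<open>q\<close>.
\<close>

locale hecke_scalar = two_sided_ideal J for J :: "'a::ring_1 set" +
  fixes q qi z :: 'a
  assumes q_central: "q * x = x * q" and qi_central: "qi * x = x * qi"
    and q_qi: "q * qi = 1" and z_def: "z = q - qi"
begin

lemma qi_q: "qi * q = 1"
  using q_qi q_central[of qi] by simp

lemma z_central: "z * x = x * z"
  using q_central[of x] qi_central[of x] by (simp add: z_def algebra_simps)

text \<open>
  As rewrite rules, the next three facts are to be instantiated with a fixed \<open>x\<close>: with \<open>x\<close>
  arbitrary, two scalars would be interchanged for ever.
\<close>

lemma q_pull: "x * q = q * x" "x * (q * y) = q * (x * y)"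
  by (simp_all add: q_central[of x] q_central[of "x * y"] q_central[of y] mult.assoc)

lemma qi_pull: "x * qi = qi * x" "x * (qi * y) = qi * (x * y)"
  by (simp_all add: qi_central[of x] qi_central[of "x * y"] qi_central[of y] mult.assoc)

lemma z_pull: "x * z = z * x" "x * (z * y) = z * (x * y)"
  by (simp_all add: z_central[of x] z_central[of "x * y"] z_central[of y] mult.assoc)

lemma cancel_qi: "qi * (q * x) = x" and cancel_q: "q * (qi * x) = x"
  by (simp_all add: mult.assoc[symmetric] qi_q q_qi)

lemma mem_scaled_iff: "qi * x \<in> J \<longleftrightarrow> x \<in> J"
  using mult_mem_left[of x qi] mult_mem_left[of "qi * x" q] by (auto simp: cancel_q)

text \<open>
  For idempotent \<open>P\<close> and \<open>T\<close> with the quadratic relation, this is \<open>q P T\<inverse> P\<close>, the element that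
  (R5) attaches to \<open>P\<^sub>i\<close> and \<open>T\<^sub>i\<close>; see \<open>next_idem_alt\<close> and \<open>hecke_inverse\<close>.
\<close>

definition next_idem :: "'a \<Rightarrow> 'a \<Rightarrow> 'a" where
  "next_idem P T = q * (P * T * P - z * P)"

lemma mem_add_iff: "y \<in> J \<Longrightarrow> x + y \<in> J \<longleftrightarrow> x \<in> J"
  using add_mem[of x y] diff_mem[of "x + y" y] by auto

text \<open>
  This translates (B3). Expanding the products, the difference of the two sides is
  \<open>q\<inverse>(FT - TF)\<close> with \<open>F = next_idem P T\<close>, up to terms that vanish by the quadratic relation.
\<close>

lemma complement_braid_iff_commute:
  assumes quad: "T * T \<approx> z * T + 1"
  shows "(1 - P) * T * (1 - P) * T \<approx> T * (1 - P) * T * (1 - P) \<longleftrightarrow>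
    next_idem P T * T \<approx> T * next_idem P T"
proof -
  let ?F = "next_idem P T" and ?d = "T * T - (z * T + 1)"
  have d: "?d \<in> J" using quad by (simp add: eqv_def)
  have F: "qi * ?F = P * T * P - z * P"
    by (simp add: next_idem_def cancel_qi)
  have "qi * (?F * T - T * ?F) = (P * T * P - z * P) * T - T * (P * T * P - z * P)"
    unfolding F[symmetric] by (simp add: algebra_simps qi_pull[of T])
  also have "\<dots> = (1 - P) * T * (1 - P) * T - T * (1 - P) * T * (1 - P) - (?d * P - P * ?d)"
    by (simp add: algebra_simps z_pull[of P] z_pull[of T])
  finally have "(1 - P) * T * (1 - P) * T - T * (1 - P) * T * (1 - P) =
      qi * (?F * T - T * ?F) + (?d * P - P * ?d)"
    by (simp only: diff_add_cancel)
  moreover have "?d * P - P * ?d \<in> J"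
    by (intro diff_mem mult_mem_left mult_mem_right d)
  ultimately show ?thesis
    by (simp only: eqv_def mem_add_iff mem_scaled_iff)
qed

text \<open>
  Both \<open>P T P\<close> and \<open>P\<close> begin and end with the idempotent \<open>P\<close>.
\<close>

lemma next_idem_absorb:
  assumes "P * P \<approx> P"
  shows "P * next_idem P T \<approx> next_idem P T" "next_idem P T * P \<approx> next_idem P T"
proof -
  have "P * next_idem P T = q * ((P * P) * (T * P) - z * (P * P))"
    by (simp add: next_idem_def algebra_simps q_pull[of P] z_pull[of P])
  also have "\<dots> \<approx> q * (P * (T * P) - z * P)"
    by (intro eqv_left eqv_diff eqv_right assms)
  finally show "P * next_idem P T \<approx> next_idem P T"
    by (simp add: next_idem_def mult.assoc)
  have "next_idem P T * P = q * ((P * T) * (P * P) - z * (P * P))"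
    by (simp add: next_idem_def algebra_simps)
  also have "\<dots> \<approx> q * ((P * T) * P - z * P)"
    by (intro eqv_left eqv_diff eqv_right assms)
  finally show "next_idem P T * P \<approx> next_idem P T"
    by (simp add: next_idem_def mult.assoc)
qed

text \<open>
  This translates (B4). With \<open>F = next_idem P T\<close>, the first three factors of (B4) are
  \<open>q\<inverse>(F - P)\<close> and the last one is \<open>TPT - zT\<close>. Here \<open>F(TPT - zT) = F\<close> because \<open>F\<close> commutes
  with \<open>T\<close> and absorbs \<open>P\<close>, while \<open>T\<^sup>2 - zT = 1\<close>, and \<open>P(TPT - zT) = q\<inverse>FT\<close>, so (B4) reads \<open>F = q\<inverse>FT\<close>.
\<close>

lemma quartic_iff_eigen:
  assumes quad: "T * T \<approx> z * T + 1" and idem: "P * P \<approx> P"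
    and comm: "next_idem P T * T \<approx> T * next_idem P T"
  shows "P * (T - q) * P * (1 - T * (1 - P) * T) \<approx> 0 \<longleftrightarrow>
    next_idem P T * T \<approx> q * next_idem P T"
proof -
  define F where "F = next_idem P T"
  have F: "P * T * P - z * P = qi * F"
    by (simp add: F_def next_idem_def cancel_qi)
  then have PTP: "P * (T * P) = qi * F + z * P"
    by (simp add: algebra_simps)
  note absorb = next_idem_absorb(2)[OF idem, of T, folded F_def]
  have "P * (T - q) * P = (P * T * P - z * P) - qi * P - q * (P * P - P)"
    by (simp add: z_def algebra_simps q_pull[of P] qi_pull[of P])
  also have "\<dots> = qi * (F - P) - q * (P * P - P)"
    by (simp add: PTP algebra_simps)
  also have "\<dots> \<approx> qi * (F - P)"
    using idem by (simp add: eqv_def minus_mem mult_mem_left)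
  finally have 1: "P * (T - q) * P \<approx> qi * (F - P)" .
  have "1 - T * (1 - P) * T = T * P * T - z * T - (T * T - (z * T + 1))"
    by (simp add: algebra_simps)
  also have "\<dots> \<approx> T * P * T - z * T"
    using minus_mem[OF quad[unfolded eqv_def]] by (simp add: eqv_def algebra_simps)
  finally have 2: "1 - T * (1 - P) * T \<approx> T * P * T - z * T" .
  have "P * (T - q) * P * (1 - T * (1 - P) * T) \<approx> qi * (F - P) * (T * P * T - z * T)"
    by (rule eqv_mult[OF 1 2])
  also have "\<dots> = qi * (F * T * (P * T) - z * (F * T) - (P * T * P - z * P) * T)"
    by (simp add: algebra_simps z_pull[of P] z_pull[of F] z_pull[of T])
  also have "\<dots> = qi * (F * T * (P * T) - z * (F * T) - qi * (F * T))"
    by (simp only: F) (simp add: mult.assoc)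
  also have "\<dots> \<approx> qi * (F - qi * (F * T))"
  proof (intro eqv_left eqv_diff eqv_refl)
    have "F * T * (P * T) \<approx> T * F * (P * T)"
      by (rule eqv_right) (rule comm[folded F_def])
    also have "\<dots> = T * (F * P * T)" by (simp add: mult.assoc)
    also have "\<dots> \<approx> T * (F * T)" by (intro eqv_left eqv_right absorb)
    also have "\<dots> = T * F * T" by (simp add: mult.assoc)
    also have "\<dots> \<approx> F * T * T" by (rule eqv_right, rule eqv_sym, rule comm[folded F_def])
    finally have "F * T * (P * T) - z * (F * T) \<approx> F * T * T - z * (F * T)"
      by (rule eqv_diff) simp
    also have "\<dots> = F * (T * T - z * T)"
      by (simp add: algebra_simps z_pull[of F])
    also have "\<dots> \<approx> F * 1"
      by (rule eqv_left) (use quad in \<open>simp add: eqv_def algebra_simps\<close>)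
    finally show "F * T * (P * T) - z * (F * T) \<approx> F" by simp
  qed
  finally have "P * (T - q) * P * (1 - T * (1 - P) * T) \<approx> qi * (F - qi * (F * T))" .
  then have "P * (T - q) * P * (1 - T * (1 - P) * T) \<approx> 0 \<longleftrightarrow> qi * (F - qi * (F * T)) \<approx> 0"
    using eqv_trans eqv_sym by blast
  also have "\<dots> \<longleftrightarrow> qi * (q * F - F * T) \<in> J"
  proof -
    have "qi * (q * F - F * T) = F - qi * (F * T)"
      by (simp add: right_diff_distrib cancel_qi)
    then show ?thesis by (simp only: eqv_def diff_0_right mem_scaled_iff)
  qed
  also have "\<dots> \<longleftrightarrow> F * T \<approx> q * F"
    using eqv_sym by (auto simp: mem_scaled_iff eqv_def)
  finally show ?thesis by (simp add: F_def)
qed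

text \<open>
  In \<open>F \<sqdot> q(PTP - zP)\<close> with \<open>F = next_idem P T\<close>, absorption and \<open>FT = qF\<close> leave
  \<open>q(q - z)F\<close>, and \<open>q - z = q\<inverse>\<close>.
\<close>

lemma next_idem_idem:
  assumes "P * P \<approx> P" "next_idem P T * T \<approx> q * next_idem P T"
  shows "next_idem P T * next_idem P T \<approx> next_idem P T"
proof -
  define F where "F = next_idem P T"
  have P: "F * P \<approx> F" using next_idem_absorb(2)[OF assms(1)] by (simp add: F_def)
  have "F * F = q * ((F * P) * (T * P) - z * (F * P))"
    unfolding F_def[symmetric] by (subst (2) F_def)
      (simp add: next_idem_def algebra_simps q_pull[of F] z_pull[of F])
  also have "\<dots> \<approx> q * (F * (T * P) - z * F)"
    by (intro eqv_left eqv_diff eqv_right P)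
  also have "\<dots> = q * ((F * T) * P - z * F)" by (simp add: mult.assoc)
  also have "\<dots> \<approx> q * (q * F * P - z * F)"
    by (intro eqv_left eqv_diff eqv_right eqv_refl assms(2)[folded F_def])
  also have "\<dots> = q * (q * (F * P) - z * F)" by (simp add: mult.assoc)
  also have "\<dots> \<approx> q * (q * F - z * F)"
    by (intro eqv_left eqv_diff eqv_refl P)
  also have "\<dots> = F" by (simp add: z_def algebra_simps cancel_q)
  finally show ?thesis by (simp add: F_def)
qed

lemma next_idem_alt:
  assumes "P * P \<approx> P"
  shows "q * P * (T - z) * P \<approx> next_idem P T"
proof -
  have "q * P * (T - z) * P = q * (P * T * P - z * (P * P))"
    by (simp add: algebra_simps z_pull[of P])
  also have "\<dots> \<approx> q * (P * T * P - z * P)"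
    by (intro eqv_left eqv_diff eqv_refl assms)
  finally show ?thesis by (simp add: next_idem_def)
qed

lemma hecke_inverse:
  assumes "T * T \<approx> z * T + 1"
  shows "T * (T - z) \<approx> 1" "(T - z) * T \<approx> 1"
  using assms by (simp_all add: eqv_def algebra_simps z_pull[of T])

text \<open>
  These are the braid relation in the forms \<open>S R\<inverse> S\<inverse> = R\<inverse> S\<inverse> R\<close> and
  \<open>S\<inverse> R\<inverse> S = R S\<inverse> R\<inverse>\<close>.
\<close>

lemma braid_conjugate:
  assumes R: "R * R \<approx> z * R + 1" and S: "S * S \<approx> z * S + 1"
    and braid: "R * S * R \<approx> S * R * S"
  shows "S * ((R - z) * (S - z)) \<approx> (R - z) * ((S - z) * R)"
    and "(S - z) * ((R - z) * S) \<approx> R * ((S - z) * (R - z))"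
proof -
  define R' S' where "R' = R - z" and "S' = S - z"
  note inv = hecke_inverse[OF R, folded R'_def] hecke_inverse[OF S, folded S'_def]
  \<comment> \<open>Inserting \<open>R' R\<close> and \<open>S' S\<close> creates a factor \<open>S R S\<close>, after which the inverses cancel.\<close>
  have "S * (R' * S') \<approx> R' * R * (S * (R' * S'))"
    using eqv_right[OF eqv_sym[OF inv(2)], of "S * (R' * S')"] by simp
  also have "\<dots> \<approx> R' * (S' * S) * (R * (S * (R' * S')))"
    using eqv_left[OF eqv_right[OF eqv_sym[OF inv(4)], of "R * (S * (R' * S'))"], of R']
    by (simp add: mult.assoc)
  also have "\<dots> = R' * S' * (S * R * S) * (R' * S')" by (simp add: mult.assoc)
  also have "\<dots> \<approx> R' * S' * (R * S * R) * (R' * S')"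
    by (intro eqv_left eqv_right eqv_sym[OF braid])
  also have "\<dots> = R' * S' * R * S * (R * R') * S'" by (simp add: mult.assoc)
  also have "\<dots> \<approx> R' * S' * R * S * 1 * S'"
    by (intro eqv_left eqv_right inv)
  also have "\<dots> = R' * S' * R * (S * S')" by (simp add: mult.assoc)
  also have "\<dots> \<approx> R' * S' * R * 1"
    by (intro eqv_left inv)
  finally show "S * (R' * S') \<approx> R' * (S' * R)" by (simp add: mult.assoc)
  \<comment> \<open>Here \<open>R R'\<close> and \<open>S S'\<close> are inserted on the right, to the same effect.\<close>
  have "S' * (R' * S) \<approx> S' * R' * S * (R * R')"
    using eqv_left[OF eqv_sym[OF inv(1)], of "S' * R' * S"] by (simp add: mult.assoc)
  also have "\<dots> \<approx> S' * R' * S * R * (S * S') * R'"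
    using eqv_right[OF eqv_left[OF eqv_sym[OF inv(3)], of "S' * R' * S * R"], of R']
    by (simp add: mult.assoc)
  also have "\<dots> = S' * R' * (S * R * S) * (S' * R')" by (simp add: mult.assoc)
  also have "\<dots> \<approx> S' * R' * (R * S * R) * (S' * R')"
    by (intro eqv_left eqv_right eqv_sym[OF braid])
  also have "\<dots> = S' * (R' * R) * (S * R * S' * R')" by (simp add: mult.assoc)
  also have "\<dots> \<approx> S' * 1 * (S * R * S' * R')"
    by (intro eqv_left eqv_right inv)
  also have "\<dots> = (S' * S) * (R * S' * R')" by (simp add: mult.assoc)
  also have "\<dots> \<approx> 1 * (R * S' * R')"
    by (intro eqv_right inv)
  finally show "S' * (R' * S) \<approx> R * (S' * R')" by (simp add: mult.assoc)
qed

text \<open>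
  This is the inductive step of the relation \<open>T\<^sub>iP\<^sub>i\<^sub>+\<^sub>1 = P\<^sub>i\<^sub>+\<^sub>1T\<^sub>i = qP\<^sub>i\<^sub>+\<^sub>1\<close>, for
  \<open>R = T\<^sub>i\<^sub>-\<^sub>1\<close>, \<open>S = T\<^sub>i\<close>, \<open>E = P\<^sub>i\<^sub>-\<^sub>1\<close>, \<open>F = P\<^sub>i\<close> and \<open>P\<^sub>i\<^sub>+\<^sub>1 = next_idem F S\<close>. As \<open>E\<close> commutes with
  \<open>S\<inverse>\<close> and is absorbed by \<open>F\<close>, the last element can be written with a single factor \<open>F\<close>, as
  \<open>q\<^sup>2 E R\<inverse> S\<inverse> F\<close> or as \<open>q\<^sup>2 F S\<inverse> R\<inverse> E\<close>. A factor \<open>S\<close> passes through \<open>E\<close>, becomes \<open>R\<close> by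
  the braid relation, and is turned into \<open>q\<close> by \<open>F\<close>.
\<close>

lemma next_idem_top_eigen:
  assumes R: "R * R \<approx> z * R + 1" and S: "S * S \<approx> z * S + 1"
    and braid: "R * S * R \<approx> S * R * S"
    and E: "E * E \<approx> E" "E * S \<approx> S * E"
    and F: "F = next_idem E R" "F * F \<approx> F" "R * F \<approx> q * F" "F * R \<approx> q * F"
  shows "S * next_idem F S \<approx> q * next_idem F S" "next_idem F S * S \<approx> q * next_idem F S"
proof -
  define R' S' G where "R' = R - z" and "S' = S - z" and "G = next_idem F S"
  note conj = braid_conjugate[OF R S braid, folded R'_def S'_def]
  have F': "F \<approx> q * E * R' * E"
    using eqv_sym[OF next_idem_alt[OF E(1)]] by (simp add: F(1) R'_def)
  have G': "G \<approx> q * F * S' * F"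
    using eqv_sym[OF next_idem_alt[OF F(2)]] by (simp add: G_def S'_def)
  have EF: "E * F \<approx> F" and FE: "F * E \<approx> F"
    unfolding F(1) by (rule next_idem_absorb[OF E(1)])+
  have ES': "E * S' \<approx> S' * E"
    using E(2) z_central[of E] by (simp add: S'_def eqv_def algebra_simps)
  have "G \<approx> q * (F * (S' * F))" using G' by (simp add: mult.assoc)
  also have "\<dots> \<approx> q * ((q * E * R' * E) * (S' * F))" by (intro eqv_left eqv_right F')
  also have "\<dots> = q * (q * (E * (R' * ((E * S') * F))))" by (simp add: mult.assoc)
  also have "\<dots> \<approx> q * (q * (E * (R' * ((S' * E) * F))))" by (intro eqv_left eqv_right ES')
  also have "\<dots> = q * (q * (E * (R' * (S' * (E * F)))))" by (simp add: mult.assoc)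
  also have "\<dots> \<approx> q * (q * (E * (R' * (S' * F))))" by (intro eqv_left EF)
  finally have left: "G \<approx> q * (q * (E * (R' * (S' * F))))" .
  have "S * G \<approx> S * (q * (q * (E * (R' * (S' * F)))))" by (rule eqv_left[OF left])
  also have "\<dots> = q * (q * ((S * E) * (R' * (S' * F))))"
    by (simp add: q_pull[of S] mult.assoc)
  also have "\<dots> \<approx> q * (q * ((E * S) * (R' * (S' * F))))"
    by (intro eqv_left eqv_right eqv_sym[OF E(2)])
  also have "\<dots> = q * (q * (E * ((S * (R' * S')) * F)))" by (simp add: mult.assoc)
  also have "\<dots> \<approx> q * (q * (E * ((R' * (S' * R)) * F)))" by (intro eqv_left eqv_right conj)
  also have "\<dots> = q * (q * (E * (R' * (S' * (R * F)))))" by (simp add: mult.assoc)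
  also have "\<dots> \<approx> q * (q * (E * (R' * (S' * (q * F)))))" by (intro eqv_left F)
  also have "\<dots> = q * (q * (q * (E * (R' * (S' * F)))))"
    by (simp add: q_pull[of E] q_pull[of R'] q_pull[of S'] mult.assoc)
  also have "\<dots> \<approx> q * G" by (rule eqv_left[OF eqv_sym[OF left]])
  finally show "S * next_idem F S \<approx> q * next_idem F S" by (simp add: G_def)
  have "G \<approx> q * (F * S' * F)" using G' by (simp add: mult.assoc)
  also have "\<dots> \<approx> q * (F * S' * (q * E * R' * E))" by (intro eqv_left F')
  also have "\<dots> = q * (q * (F * (S' * E) * (R' * E)))"
    by (simp add: q_pull[of F] q_pull[of S'] mult.assoc)
  also have "\<dots> \<approx> q * (q * (F * (E * S') * (R' * E)))"
    by (intro eqv_left eqv_right eqv_sym[OF ES'])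
  also have "\<dots> = q * (q * ((F * E) * (S' * (R' * E))))" by (simp add: mult.assoc)
  also have "\<dots> \<approx> q * (q * (F * (S' * (R' * E))))" by (intro eqv_left eqv_right FE)
  finally have right: "G \<approx> q * (q * (F * (S' * (R' * E))))" .
  have "G * S \<approx> q * (q * (F * (S' * (R' * E)))) * S" by (rule eqv_right[OF right])
  also have "\<dots> = q * (q * (F * (S' * (R' * (E * S)))))" by (simp add: mult.assoc)
  also have "\<dots> \<approx> q * (q * (F * (S' * (R' * (S * E)))))" by (intro eqv_left E)
  also have "\<dots> = q * (q * (F * ((S' * (R' * S)) * E)))" by (simp add: mult.assoc)
  also have "\<dots> \<approx> q * (q * (F * ((R * (S' * R')) * E)))" by (intro eqv_left eqv_right conj)
  also have "\<dots> = q * (q * ((F * R) * (S' * (R' * E))))" by (simp add: mult.assoc)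
  also have "\<dots> \<approx> q * (q * ((q * F) * (S' * (R' * E))))" by (intro eqv_left eqv_right F)
  also have "\<dots> = q * (q * (q * (F * (S' * (R' * E)))))" by (simp add: mult.assoc)
  also have "\<dots> \<approx> q * G" by (rule eqv_left[OF eqv_sym[OF right]])
  finally show "next_idem F S * S \<approx> q * next_idem F S" by (simp add: G_def)
qed

lemma next_idem_commute:
  assumes "P * A \<approx> A * P" "T * A \<approx> A * T"
  shows "next_idem P T * A \<approx> A * next_idem P T"
proof -
  have "P * T * P * A = P * T * (P * A)" by (simp add: mult.assoc)
  also have "\<dots> \<approx> P * T * (A * P)" by (intro eqv_left assms)
  also have "\<dots> = P * (T * A) * P" by (simp add: mult.assoc)
  also have "\<dots> \<approx> P * (A * T) * P" by (intro eqv_left eqv_right assms)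
  also have "\<dots> = (P * A) * (T * P)" by (simp add: mult.assoc)
  also have "\<dots> \<approx> (A * P) * (T * P)" by (intro eqv_right assms)
  finally have PTP: "P * T * P * A \<approx> A * P * (T * P)" .
  have "next_idem P T * A = q * (P * T * P * A - z * (P * A))"
    by (simp add: next_idem_def algebra_simps)
  also have "\<dots> \<approx> q * (A * P * (T * P) - z * (A * P))"
    by (intro eqv_left eqv_diff PTP assms)
  also have "\<dots> = A * next_idem P T"
    by (simp add: next_idem_def algebra_simps q_pull[of A] z_pull[of A])
  finally show ?thesis .
qed

lemma next_idem_inherits_eigen_right:
  assumes "P * A \<approx> q * P"
  shows "next_idem P T * A \<approx> q * next_idem P T"
proof -
  have "next_idem P T * A = q * (P * T * (P * A) - z * (P * A))"
    by (simp add: next_idem_def algebra_simps)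
  also have "\<dots> \<approx> q * (P * T * (q * P) - z * (q * P))"
    by (intro eqv_left eqv_diff assms)
  also have "\<dots> = q * next_idem P T"
    by (simp add: next_idem_def algebra_simps q_pull[of P] q_pull[of T] q_pull[of z])
  finally show ?thesis .
qed

lemma next_idem_inherits_eigen_left:
  assumes "A * P \<approx> q * P"
  shows "A * next_idem P T \<approx> q * next_idem P T"
proof -
  have "A * next_idem P T = q * ((A * P) * T * P - z * (A * P))"
    by (simp add: next_idem_def algebra_simps q_pull[of A] z_pull[of A])
  also have "\<dots> \<approx> q * ((q * P) * T * P - z * (q * P))"
    by (intro eqv_left eqv_diff eqv_right assms)
  also have "\<dots> = q * next_idem P T"
    by (simp add: next_idem_def algebra_simps q_pull[of z])
  finally show ?thesis .
qed

lemma next_idem_cong: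
  assumes "P \<approx> P'"
  shows "next_idem P T \<approx> next_idem P' T"
  unfolding next_idem_def
  by (intro eqv_left eqv_diff eqv_mult eqv_refl assms)

end

text \<open>
  The hypotheses are what the relations of \<open>A\<^sub>k\<close> give directly, with (B3) and (B4) replaced by
  the equivalent \<open>P2_eigen\<close>; the relations of \<open>R\<^sub>k\<close> are derived from them.
\<close>

locale idem_tower = hecke_scalar J q qi z for J :: "'a::ring_1 set" and q qi z +
  fixes T P :: "nat \<Rightarrow> 'a" and k :: nat
  assumes quad: "1 \<le> i \<Longrightarrow> i < k \<Longrightarrow> T i * T i \<approx> z * T i + 1"
    and braid: "1 \<le> i \<Longrightarrow> i + 1 < k \<Longrightarrow> T i * T (i+1) * T i \<approx> T (i+1) * T i * T (i+1)"
    and far: "1 \<le> i \<Longrightarrow> i + 1 < j \<Longrightarrow> j < k \<Longrightarrow> T i * T j \<approx> T j * T i"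
    and P_Suc: "1 \<le> i \<Longrightarrow> i < k \<Longrightarrow> P (i+1) = next_idem (P i) (T i)"
    and P1_idem: "P 1 * P 1 \<approx> P 1"
    and P1_far: "1 < j \<Longrightarrow> j < k \<Longrightarrow> P 1 * T j \<approx> T j * P 1"
    and P2_eigen: "1 < k \<Longrightarrow> T 1 * P 2 \<approx> q * P 2" "1 < k \<Longrightarrow> P 2 * T 1 \<approx> q * P 2"
begin

text \<open>
  The three parts need each other in the induction: a new level is idempotent by its
  eigenvalue relation, and the latter uses, two levels down, idempotence and commutation.
\<close>

lemma tower_relations:
  assumes "1 \<le> i" "i \<le> k"
  shows "P i * P i \<approx> P i \<and>
    (\<forall>j. i < j \<and> j < k \<longrightarrow> P i * T j \<approx> T j * P i) \<and>
    (\<forall>j. 1 \<le> j \<and> j < i \<longrightarrow> P i * T j \<approx> q * P i \<and> T j * P i \<approx> q * P i)"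
  using assms
proof (induction i rule: less_induct)
  case (less i)
  show ?case
  proof (cases "i = 1")
    case True
    then show ?thesis using P1_idem P1_far by auto
  next
    case False
    define m where "m = i - 1"
    have m: "i = m + 1" "1 \<le> m" "m < k" using False less.prems by (auto simp: m_def)
    have Pi: "P i = next_idem (P m) (T m)" using P_Suc m by simp
    have IH: "P m * P m \<approx> P m" "\<And>j. m < j \<Longrightarrow> j < k \<Longrightarrow> P m * T j \<approx> T j * P m"
        "\<And>j. 1 \<le> j \<Longrightarrow> j < m \<Longrightarrow> P m * T j \<approx> q * P m"
        "\<And>j. 1 \<le> j \<Longrightarrow> j < m \<Longrightarrow> T j * P m \<approx> q * P m"
      using less.IH[of m] m by auto
    have top: "T m * P i \<approx> q * P i \<and> P i * T m \<approx> q * P i"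
    proof (cases "m = 1")
      case True
      then show ?thesis using P2_eigen m by (auto simp: numeral_2_eq_2)
    next
      case False
      define l where "l = m - 1"
      have l: "m = l + 1" "1 \<le> l" "l < k" using False m by (auto simp: l_def)
      have IHl: "P l * P l \<approx> P l" "P l * T m \<approx> T m * P l"
        using less.IH[of l] l m by auto
      have "P m = next_idem (P l) (T l)" using P_Suc l by simp
      moreover have "T l * T m * T l \<approx> T m * T l * T m" using braid[of l] l m by simp
      ultimately show ?thesis
        using next_idem_top_eigen[of "T l" "T m" "P l" "P m"] quad[of l] quad[of m] IHl IH l m
        unfolding Pi by auto
    qed
    have "P i * P i \<approx> P i"
      using next_idem_idem[OF IH(1)] top by (simp add: Pi)
    moreover have "P i * T j \<approx> T j * P i" if "i < j" "j < k" for j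
      unfolding Pi using that m by (intro next_idem_commute IH far) auto
    moreover have "P i * T j \<approx> q * P i \<and> T j * P i \<approx> q * P i" if "1 \<le> j" "j < i" for j
    proof (cases "j = m")
      case True
      then show ?thesis using top by simp
    next
      case False
      then have "j < m" using that m by simp
      then show ?thesis
        unfolding Pi using that by (intro conjI next_idem_inherits_eigen_left next_idem_inherits_eigen_right IH)
    qed
    ultimately show ?thesis by blast
  qed
qed

lemmas P_idem = tower_relations[THEN conjunct1]
  and P_far = tower_relations[THEN conjunct2, THEN conjunct1, rule_format]
  and P_eigen = tower_relations[THEN conjunct2, THEN conjunct2, rule_format]

text \<open>
  Consecutive levels absorb by \<open>next_idem_absorb\<close>, and absorption is transitive.
\<close>

lemma P_absorb:
  assumes "1 \<le> i" "i \<le> j" "j \<le> k"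
  shows "P i * P j \<approx> P j \<and> P j * P i \<approx> P j"
  using assms(2,3)
proof (induction j rule: dec_induct)
  case base
  then show ?case using P_idem assms by simp
next
  case (step n)
  have Pn: "P (Suc n) = next_idem (P n) (T n)" using P_Suc[of n] step assms by simp
  have idem: "P n * P n \<approx> P n" using P_idem[of n] step assms by simp
  note absorb = next_idem_absorb[OF idem, of "T n", folded Pn]
  have IH: "P i * P n \<approx> P n" "P n * P i \<approx> P n" using step by auto
  have "P i * P (Suc n) \<approx> P i * (P n * P (Suc n))"
    by (intro eqv_left eqv_sym[OF absorb(1)])
  also have "\<dots> = (P i * P n) * P (Suc n)" by (simp add: mult.assoc)
  also have "\<dots> \<approx> P n * P (Suc n)" by (intro eqv_right IH)
  also have "\<dots> \<approx> P (Suc n)" by (rule absorb)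
  finally have 1: "P i * P (Suc n) \<approx> P (Suc n)" .
  have "P (Suc n) * P i \<approx> (P (Suc n) * P n) * P i"
    by (intro eqv_right eqv_sym[OF absorb(2)])
  also have "\<dots> = P (Suc n) * (P n * P i)" by (simp add: mult.assoc)
  also have "\<dots> \<approx> P (Suc n) * P n" by (intro eqv_left IH)
  also have "\<dots> \<approx> P (Suc n)" by (rule absorb)
  finally show ?case using 1 by blast
qed

lemma P_commute:
  assumes "1 \<le> i" "i \<le> k" "1 \<le> j" "j \<le> k"
  shows "P i * P j \<approx> P j * P i"
proof (cases "i \<le> j")
  case True
  then show ?thesis using P_absorb[of i j] assms eqv_trans eqv_sym by blast
next
  case False
  then show ?thesis using P_absorb[of j i] assms eqv_trans eqv_sym by (meson nat_le_linear)
qed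

end


section \<open>Presentations and substitutions\<close>

text \<open>
  Killing the generators outside \<open>G\<close> is a homomorphism that restricts to the identity on the
  free algebra on \<open>G\<close>. The preimage of the ideal of relations is therefore a two-sided ideal
  of the free algebra on the whole type that meets the free algebra on \<open>G\<close> in the ideal of
  relations.
\<close>

definition retract :: "'g set \<Rightarrow> 'g free \<Rightarrow> 'g free" where
  "retract G = lift (\<lambda>g. if g \<in> G then gen g else 0)"

definition extended_ideal :: "'g set \<Rightarrow> ('g free \<times> 'g free) set \<Rightarrow> 'g free set" where
  "extended_ideal G E = {f. retract G f \<in> rel_ideal G E}"

lemma retract_closed: "retract G f \<in> carrier (free_algebra G)"
  unfolding retract_def
  by (rule lift_closed[of f UNIV]) (auto simp: free_carrier_iff[where G = UNIV] gen_closed)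

lemma retract_id: "f \<in> carrier (free_algebra G) \<Longrightarrow> retract G f = f"
  unfolding retract_def
  by (induction f rule: free_algebra_induct) (auto simp: lift_hom)

locale presentation =
  fixes G :: "'g set" and E :: "('g free \<times> 'g free) set"
  assumes wf: "wf_rels G E"

sublocale presentation \<subseteq> two_sided_ideal "extended_ideal G E"
proof -
  interpret I: ideal "rel_ideal G E" "free_algebra G"
    by (rule rel_ideal_ideal[OF wf])
  show "two_sided_ideal (extended_ideal G E)"
  proof
    show "0 \<in> extended_ideal G E"
      using I.a_subgroup additive_subgroup.zero_closed[OF I.additive_subgroup_axioms]
      by (simp add: extended_ideal_def retract_def)
    show "x + y \<in> extended_ideal G E" if "x \<in> extended_ideal G E" "y \<in> extended_ideal G E" for x y
      using that additive_subgroup.a_closed[OF I.additive_subgroup_axioms, of "retract G x" "retract G y"]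
      by (simp add: extended_ideal_def retract_def lift_hom)
    show "a * x \<in> extended_ideal G E" "x * a \<in> extended_ideal G E" if "x \<in> extended_ideal G E" for a x
      using that I.I_l_closed[of "retract G x" "retract G a"] I.I_r_closed[of "retract G x" "retract G a"]
        retract_closed[of G a]
      by (simp_all add: extended_ideal_def retract_def lift_hom)
  qed
qed

context presentation
begin

notation eqv  (infix "\<approx>" 50)

abbreviation cls :: "'g free \<Rightarrow> 'g free set" where
  "cls \<equiv> presented_class G E"

abbreviation alg :: "(complex, 'g free set) module" where
  "alg \<equiv> presented_algebra G E"

lemma eqv_iff_retract: "f \<approx> g \<longleftrightarrow> retract G (f - g) \<in> rel_ideal G E"
  by (simp only: eqv_def) (simp add: extended_ideal_def)

lemma eqv_iff_cls:
  assumes "f \<in> carrier (free_algebra G)" "g \<in> carrier (free_algebra G)"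
  shows "f \<approx> g \<longleftrightarrow> cls f = cls g"
  using assms presented_class_eq_iff[OF wf assms]
  by (simp add: eqv_iff_retract retract_id free_minus_closed)

lemma rel_eqv:
  assumes "(l, r) \<in> E"
  shows "l \<approx> r"
proof -
  have "l - r \<in> carrier (free_algebra G)"
    using assms wf by (auto simp: wf_rels_def intro!: free_minus_closed)
  then show ?thesis
    using rel_in_ideal[OF wf assms] by (simp add: eqv_iff_retract retract_id)
qed

lemma cls_add:
  assumes "f \<in> carrier (free_algebra G)" "g \<in> carrier (free_algebra G)"
  shows "cls f \<oplus>\<^bsub>alg\<^esub> cls g = cls (f + g)"
proof -
  interpret I: ideal "rel_ideal G E" "free_algebra G"
    by (rule rel_ideal_ideal[OF wf])
  show ?thesis
    using I.a_rcos_sum[OF assms]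
    by (simp add: presented_class_def presented_algebra_def quot_algebra_def FactRing_def)
qed

lemma cls_one: "cls 1 = \<one>\<^bsub>alg\<^esub>"
  by (simp add: presented_algebra_def quot_algebra_def FactRing_def presented_class_def)

lemma carrier_alg: "carrier alg = cls ` carrier (free_algebra G)"
  by (auto simp: presented_algebra_def quot_algebra_def FactRing_def presented_class_def A_RCOSETS_def')

lemma cls_diff:
  assumes "f \<in> carrier (free_algebra G)" "g \<in> carrier (free_algebra G)"
  shows "cls f \<ominus>\<^bsub>alg\<^esub> cls g = cls (f - g)"
proof -
  interpret R: ring alg by (rule ring_presented_algebra[OF wf])
  have "cls (f - g) \<oplus>\<^bsub>alg\<^esub> cls g = cls f"
    using assms by (simp add: cls_add free_minus_closed)
  moreover have "cls f \<in> carrier alg" "cls g \<in> carrier alg" "cls (f - g) \<in> carrier alg"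
    using assms by (auto simp: carrier_alg free_minus_closed)
  ultimately show ?thesis
    by (metis R.add.inv_closed R.add.m_assoc R.minus_eq R.r_neg R.r_zero)
qed

end

text \<open>
  This is the first isomorphism theorem; only the compatibility with scalars has to be
  added to the statement for rings.
\<close>

lemma is_presentation_imp_iso:
  assumes wf: "wf_rels G E" and ring: "ring B" and pres: "is_presentation G E B x"
  shows "\<exists>\<phi>\<in>alg_iso (presented_algebra G E) B. \<forall>g\<in>G. \<phi> (presented_class G E (gen g)) = x g"
proof -
  interpret presentation G E by standard (rule wf)
  obtain h where h: "h \<in> alg_hom (free_algebra G) B" "\<And>g. g \<in> G \<Longrightarrow> h (gen g) = x g"
      "h ` carrier (free_algebra G) = carrier B" "a_kernel (free_algebra G) B h = rel_ideal G E"
    using pres by (auto simp: is_presentation_def)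
  have smult: "h (const c * f) = c \<odot>\<^bsub>B\<^esub> h f" if "f \<in> carrier (free_algebra G)" for c f
    using h(1) that by (auto simp: alg_hom_def)
  have hom: "h \<in> ring_hom (free_algebra G) B"
    using h(1) by (simp add: alg_hom_def)
  interpret R: ring_hom_ring "free_algebra G" B h
    by (rule ring_hom_ringI2[OF ring_free_algebra ring hom])
  define \<phi> where "\<phi> = (\<lambda>X. the_elem (h ` X))"
  have \<phi>_cls: "\<phi> (cls f) = h f" if "f \<in> carrier (free_algebra G)" for f
    using R.the_elem_simp[OF that] by (simp add: \<phi>_def presented_class_def h(4))
  have "\<phi> \<in> ring_iso (free_algebra G Quot rel_ideal G E) B"
    using R.FactRing_iso_set[OF h(3)] by (simp add: \<phi>_def h(4))
  then have "\<phi> \<in> ring_hom alg B" "bij_betw \<phi> (carrier alg) (carrier B)"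
    by (simp_all add: ring_iso_def ring_hom_def presented_algebra_def quot_algebra_def)
  moreover have "\<phi> (c \<odot>\<^bsub>alg\<^esub> X) = c \<odot>\<^bsub>B\<^esub> \<phi> X" if X: "X \<in> carrier alg" for c X
  proof -
    obtain f where "f \<in> carrier (free_algebra G)" "X = cls f"
      using X by (auto simp: carrier_alg)
    then show ?thesis
      by (simp add: presented_class_smult[OF wf] \<phi>_cls free_mult_closed smult)
  qed
  ultimately have "\<phi> \<in> alg_iso alg B"
    by (simp add: alg_iso_def alg_hom_def)
  then show ?thesis
    using \<phi>_cls h(2) by (intro bexI[of _ \<phi>]) (simp_all add: gen_closed)
qed

text \<open>
  Each substitution sends the relations on its side into the ideal of the other side, and the
  two composites fix the generators modulo the relations.
\<close>

locale inverse_substitutions = A: presentation G E + B: presentation H F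
  for G :: "'g set" and E and H :: "'h set" and F +
  fixes s :: "'g \<Rightarrow> 'h free" and t :: "'h \<Rightarrow> 'g free"
  assumes s_closed: "g \<in> G \<Longrightarrow> s g \<in> carrier (free_algebra H)"
    and t_closed: "h \<in> H \<Longrightarrow> t h \<in> carrier (free_algebra G)"
    and s_rels: "(l, r) \<in> E \<Longrightarrow> B.eqv (lift s l) (lift s r)"
    and t_rels: "(l', r') \<in> F \<Longrightarrow> A.eqv (lift t l') (lift t r')"
    and ts: "g \<in> G \<Longrightarrow> A.eqv (lift t (s g)) (gen g)"
    and st: "h \<in> H \<Longrightarrow> B.eqv (lift s (t h)) (gen h)"

text \<open>
  The elements that a substitution sends into a two-sided ideal form an ideal, so it is enough
  to check the defining relations.
\<close>

lemma (in presentation) lift_mem: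
  assumes I: "two_sided_ideal I" and rels: "\<And>l r. (l, r) \<in> E \<Longrightarrow> lift s l - lift s r \<in> I"
    and f: "f \<in> rel_ideal G E"
  shows "lift s f \<in> I"
proof -
  interpret I: two_sided_ideal I by (rule I)
  interpret F: ring "free_algebra G" by (rule ring_free_algebra)
  let ?K = "{f \<in> carrier (free_algebra G). lift s f \<in> I}"
  have "ideal ?K (free_algebra G)"
  proof (rule idealI)
    show "subgroup ?K (add_monoid (free_algebra G))"
    proof
      show "inv\<^bsub>add_monoid (free_algebra G)\<^esub> x \<in> ?K" if "x \<in> ?K" for x
      proof -
        have x: "0 - x \<in> carrier (free_algebra G)" "lift s (0 - x) \<in> I"
          using that I.minus_mem free_minus_closed[of 0 G x]
          by (auto simp: lift_diff simp del: diff_0) (simp add: I.minus_mem)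
        moreover have "inv\<^bsub>add_monoid (free_algebra G)\<^esub> x = 0 - x"
          using F.minus_equality[of "0 - x" x] that x by (simp add: a_inv_def)
        ultimately show ?thesis by simp
      qed
    qed (auto intro!: free_add_closed simp: lift_hom I.zero_mem I.add_mem)
  qed (auto intro!: free_mult_closed ring_free_algebra simp: lift_hom I.mult_mem_left I.mult_mem_right)
  moreover have "{l - r |l r. (l, r) \<in> E} \<subseteq> ?K"
    using wf rels by (auto simp: wf_rels_def lift_diff intro!: free_minus_closed)
  ultimately have "rel_ideal G E \<subseteq> ?K"
    unfolding rel_ideal_def by (rule F.genideal_minimal)
  then show ?thesis using f by blast
qed

lemma (in presentation) eqv_substitute:
  assumes "f \<in> carrier (free_algebra G)" "\<And>g. g \<in> G \<Longrightarrow> lift s (t g) \<approx> gen g"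
  shows "lift s (lift t f) \<approx> f"
  using assms(1) by (induction f rule: free_algebra_induct)
    (auto simp: lift_hom assms(2) eqv_add eqv_mult)

context inverse_substitutions
begin

text \<open>
  If \<open>lift s f\<close> is a consequence of \<open>F\<close>, then \<open>lift t (lift s f)\<close> is a consequence of \<open>E\<close>, and
  it is congruent to \<open>f\<close>.
\<close>

lemma mem_rel_ideal_iff:
  assumes "f \<in> carrier (free_algebra G)"
  shows "lift s f \<in> rel_ideal H F \<longleftrightarrow> f \<in> rel_ideal G E"
proof
  assume "f \<in> rel_ideal G E"
  then have "lift s f \<in> extended_ideal H F"
    by (intro A.lift_mem[OF B.two_sided_ideal_axioms]) (simp_all add: s_rels flip: B.eqv_def)
  then show "lift s f \<in> rel_ideal H F"
    using lift_closed[OF assms s_closed] by (simp add: extended_ideal_def retract_id)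
next
  assume "lift s f \<in> rel_ideal H F"
  then have "lift t (lift s f) \<in> extended_ideal G E"
    by (intro B.lift_mem[OF A.two_sided_ideal_axioms]) (simp_all add: t_rels flip: A.eqv_def)
  then have "A.eqv (lift t (lift s f)) 0" by (simp add: A.eqv_def)
  then have "A.eqv f 0"
    using A.eqv_substitute[OF assms, of t s, OF ts] A.eqv_sym A.eqv_trans by blast
  then show "f \<in> rel_ideal G E"
    using assms by (simp add: A.eqv_iff_retract retract_id)
qed

text \<open>
  The composite of \<open>lift s\<close> with the passage to classes has the required kernel by
  \<open>mem_rel_ideal_iff\<close>; it is onto because \<open>f\<close> has the same class as \<open>lift s (lift t f)\<close>.
\<close>

lemma is_presentation_substitution:
  "is_presentation G E (presented_algebra H F) (\<lambda>g. presented_class H F (s g))"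
  unfolding is_presentation_def
proof (intro bexI[of _ "\<lambda>f. B.cls (lift s f)"] conjI ballI)
  let ?h = "\<lambda>f. B.cls (lift s f)"
  have closed: "lift s f \<in> carrier (free_algebra H)" if "f \<in> carrier (free_algebra G)" for f
    using that by (rule lift_closed) (rule s_closed)
  show "?h (gen g) = B.cls (s g)" for g by simp
  show "?h \<in> alg_hom (free_algebra G) B.alg"
    unfolding alg_hom_def
    by (auto intro!: ring_hom_memI simp: B.carrier_alg closed lift_hom B.cls_add B.cls_one
        presented_class_mult[OF B.wf] presented_class_smult[OF B.wf])
  show "?h ` carrier (free_algebra G) = carrier B.alg"
  proof -
    have "B.cls f \<in> ?h ` carrier (free_algebra G)" if f: "f \<in> carrier (free_algebra H)" for f
    proof
      show t: "lift t f \<in> carrier (free_algebra G)"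
        using f by (rule lift_closed) (rule t_closed)
      show "B.cls f = ?h (lift t f)"
        using B.eqv_substitute[OF f, of s t, OF st] f closed[OF t] by (simp add: B.eqv_iff_cls)
    qed
    then show ?thesis by (auto simp: B.carrier_alg closed)
  qed
  show "a_kernel (free_algebra G) B.alg ?h = rel_ideal G E"
  proof -
    have zero: "\<zero>\<^bsub>B.alg\<^esub> = B.cls 0"
    proof -
      interpret R: ring B.alg by (rule ring_presented_algebra[OF B.wf])
      have "B.cls 0 \<in> carrier B.alg" by (simp add: B.carrier_alg)
      then show ?thesis using B.cls_add[of 0 0] R.add.l_cancel_one by fastforce
    qed
    have "?h f = \<zero>\<^bsub>B.alg\<^esub> \<longleftrightarrow> f \<in> rel_ideal G E" if "f \<in> carrier (free_algebra G)" for f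
      using that closed[OF that] unfolding zero
      by (simp add: mem_rel_ideal_iff retract_id B.eqv_iff_retract flip: B.eqv_iff_cls)
    moreover have "rel_ideal G E \<subseteq> carrier (free_algebra G)"
      using rel_ideal_ideal[OF A.wf] by (simp add: additive_subgroup.a_subset ideal.axioms(1))
    ultimately show ?thesis by (auto simp: a_kernel_def')
  qed
qed

end


section \<open>The two presentations of the rook algebra\<close>

lemma hecke_scalar_free:
  assumes "q \<noteq> 0" "two_sided_ideal J"
  shows "hecke_scalar J (const q) (const (inverse q)) (const (q - inverse q))"
proof -
  interpret two_sided_ideal J by fact
  have "const (q - inverse q) + const (inverse q) = (const q :: 'a free)"
    by (simp flip: const_add)
  then have "const (q - inverse q) = const q - (const (inverse q) :: 'a free)"
    by (simp only: eq_diff_eq)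
  moreover have "const q * const (inverse q) = (1 :: 'a free)"
    using assms(1) by (simp flip: const_mult)
  ultimately show ?thesis
    by unfold_locales (rule const_comm | assumption)+
qed

text \<open>
  The value at 0 is a default; the idempotents are indexed from 1.
\<close>

fun A_idem :: "complex \<Rightarrow> nat \<Rightarrow> A_gen free" where
  "A_idem q 0 = 0"
| "A_idem q (Suc 0) = 1 - gen AX"
| "A_idem q (Suc (Suc n)) = const q *
    (A_idem q (Suc n) * gen (AT (Suc n)) * A_idem q (Suc n) -
      const (q - inverse q) * A_idem q (Suc n))"

fun A_to_rook :: "A_gen \<Rightarrow> rook_gen free" where
  "A_to_rook AX = 1 - gen (RookP 1)"
| "A_to_rook (AT i) = gen (RookT i)"

fun rook_to_A :: "complex \<Rightarrow> rook_gen \<Rightarrow> A_gen free" where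
  "rook_to_A q (RookP i) = A_idem q i"
| "rook_to_A q (RookT i) = gen (AT i)"

lemma hecke_rels_lift:
  assumes "(l, r) \<in> hecke_rels k q T"
  shows "(lift s l, lift s r) \<in> hecke_rels k q (\<lambda>i. lift s (T i))"
  using assms unfolding hecke_rels_def
  by (elim UnE CollectE exE conjE) (simp_all add: lift_hom, blast+)

lemma A_idem_closed:
  assumes "1 \<le> i" "i \<le> k"
  shows "A_idem q i \<in> carrier (free_algebra (A_gens k))"
  using assms
  by (induction q i rule: A_idem.induct) (auto intro!: free_closed simp: A_gens_def)

lemma presentation_A: "presentation (A_gens k) (A_rels k q)"
  by standard (rule wf_A_rels)

lemma presentation_rook: "presentation (rook_gens k) (rook_rels k q)"
  by standard (rule wf_rook_rels)

lemma A_idem_tower: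
  assumes "q \<noteq> 0"
  shows "idem_tower (extended_ideal (A_gens k) (A_rels k q)) (const q) (const (inverse q))
    (const (q - inverse q)) (\<lambda>i. gen (AT i)) (A_idem q) k"
proof -
  interpret presentation "A_gens k" "A_rels k q" by (rule presentation_A)
  interpret hecke_scalar "extended_ideal (A_gens k) (A_rels k q)" "const q" "const (inverse q)"
      "const (q - inverse q)"
    by (rule hecke_scalar_free[OF assms two_sided_ideal_axioms])
  let ?X = "gen AX" and ?T = "\<lambda>i. gen (AT i)"
  have hecke: "l \<approx> r" if "(l, r) \<in> hecke_rels k q ?T" for l r
    using that by (intro rel_eqv) (simp add: A_rels_def Let_def)
  have quad: "?T i * ?T i \<approx> const (q - inverse q) * ?T i + 1" if "1 \<le> i" "i < k" for i
    using that by (intro hecke) (auto simp: hecke_rels_def)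
  have Suc: "A_idem q (i+1) = next_idem (A_idem q i) (?T i)" if "1 \<le> i" for i
    using that by (cases i) (auto simp: next_idem_def)
  have "?X * ?X \<approx> ?X" by (rule rel_eqv) (simp add: A_rels_def Let_def)
  then have idem: "A_idem q 1 * A_idem q 1 \<approx> A_idem q 1"
    by (simp add: eqv_def algebra_simps)
  have P2: "?T 1 * A_idem q 2 \<approx> const q * A_idem q 2 \<and> A_idem q 2 * ?T 1 \<approx> const q * A_idem q 2"
    if k: "1 < k"
  proof -
    have P2: "A_idem q 2 = next_idem (A_idem q 1) (?T 1)"
      using Suc[of 1] by (simp add: numeral_2_eq_2)
    have "?X * ?T 1 * ?X * ?T 1 \<approx> ?T 1 * ?X * ?T 1 * ?X"
      using k by (intro rel_eqv) (simp add: A_rels_def Let_def)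
    then have comm: "A_idem q 2 * ?T 1 \<approx> ?T 1 * A_idem q 2"
      using complement_braid_iff_commute[OF quad[of 1], of "A_idem q 1"] k by (simp add: P2)
    have "(1 - ?X) * (?T 1 - const q) * (1 - ?X) * (1 - ?T 1 * ?X * ?T 1) \<approx> 0"
      using k by (intro rel_eqv) (simp add: A_rels_def Let_def)
    then have "A_idem q 2 * ?T 1 \<approx> const q * A_idem q 2"
      using quartic_iff_eigen[OF quad[of 1] idem] comm k by (simp add: P2)
    then show ?thesis using comm eqv_sym eqv_trans by blast
  qed
  show ?thesis
  proof
    show "A_idem q 1 * ?T j \<approx> ?T j * A_idem q 1" if "1 < j" "j < k" for j
    proof -
      have "?X * ?T j \<approx> ?T j * ?X"
        using that by (intro rel_eqv) (auto simp: A_rels_def Let_def)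
      from eqv_diff[OF eqv_refl[of "?T j"] this] show ?thesis by (simp add: algebra_simps)
    qed
    show "?T i * ?T (i+1) * ?T i \<approx> ?T (i+1) * ?T i * ?T (i+1)" if "1 \<le> i" "i + 1 < k" for i
      using that by (intro hecke) (auto simp: hecke_rels_def)
    show "?T i * ?T j \<approx> ?T j * ?T i" if "1 \<le> i" "i + 1 < j" "j < k" for i j
      by (rule hecke, unfold hecke_rels_def, intro UnI2 CollectI exI[of _ i] exI[of _ j] conjI)
        (use that in auto)
  qed (use quad Suc idem P2 in auto)
qed

lemma rook_to_A_rels:
  assumes q: "q \<noteq> 0" and rel: "(l, r) \<in> rook_rels k q"
  shows "two_sided_ideal.eqv (extended_ideal (A_gens k) (A_rels k q))
    (lift (rook_to_A q) l) (lift (rook_to_A q) r)"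
proof -
  interpret presentation "A_gens k" "A_rels k q" by (rule presentation_A)
  interpret idem_tower "extended_ideal (A_gens k) (A_rels k q)" "const q" "const (inverse q)"
      "const (q - inverse q)" "\<lambda>i. gen (AT i)" "A_idem q" k
    by (rule A_idem_tower[OF q])
  let ?f = "lift (rook_to_A q)"
  have hecke: "?f l \<approx> ?f r" if "(l, r) \<in> hecke_rels k q (\<lambda>i. gen (RookT i))"
    using hecke_rels_lift[OF that, of "rook_to_A q"]
    by (intro rel_eqv) (simp add: A_rels_def Let_def)
  have inv: "A_idem q (i+1) \<approx> const q * A_idem q i * (gen (AT i) - const (q - inverse q)) * A_idem q i"
    if "1 \<le> i" "i < k" for i
    using that next_idem_alt[OF P_idem[of i], of "gen (AT i)"] P_Suc[of i] eqv_sym by simp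
  have nxt: "A_idem q (i+1) \<approx> const q * (A_idem q i * gen (AT i) * A_idem q i -
      const (q - inverse q) * A_idem q i)" if "1 \<le> i" "i < k" for i
    using that P_Suc[of i] by (simp add: next_idem_def)
  have comm: "A_idem q i * gen (AT j) \<approx> gen (AT j) * A_idem q i" if "1 \<le> j" "j < i" "i \<le> k" for i j
    using that P_eigen[of i j] eqv_sym eqv_trans by (meson le_trans less_imp_le)
  show ?thesis
    using rel unfolding rook_rels_def Let_def Un_iff
    by (elim disjE CollectE exE conjE)
      (simp_all add: lift_hom rook_Tinv_def hecke P_idem P_commute P_far comm P_eigen inv[simplified] nxt[simplified])
qed

lemma rook_rels_memI:
  defines "P \<equiv> \<lambda>i. gen (RookP i)" and "T \<equiv> \<lambda>i. gen (RookT i)"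
  shows "1 \<le> i \<Longrightarrow> i \<le> k \<Longrightarrow> (P i * P i, P i) \<in> rook_rels k q"
    and "1 \<le> i \<Longrightarrow> i < j \<Longrightarrow> j < k \<Longrightarrow> (P i * T j, T j * P i) \<in> rook_rels k q"
    and "1 \<le> j \<Longrightarrow> j < i \<Longrightarrow> i \<le> k \<Longrightarrow> (P i * T j, T j * P i) \<in> rook_rels k q"
    and "1 \<le> j \<Longrightarrow> j < i \<Longrightarrow> i \<le> k \<Longrightarrow> (T j * P i, const q * P i) \<in> rook_rels k q"
    and "1 \<le> i \<Longrightarrow> i < k \<Longrightarrow>
      (P (i+1), const q * (P i * T i * P i - const (q - inverse q) * P i)) \<in> rook_rels k q"
proof -
  assume "1 \<le> i" "i \<le> k"
  then show "(P i * P i, P i) \<in> rook_rels k q"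
    unfolding rook_rels_def Let_def P_def T_def
    by (intro UnI1[OF UnI1[OF UnI1[OF UnI1[OF UnI1[OF UnI1[OF UnI2]]]]]]) blast
next
  assume "1 \<le> i" "i < j" "j < k"
  then show "(P i * T j, T j * P i) \<in> rook_rels k q"
    unfolding rook_rels_def Let_def P_def T_def
    by (intro UnI1[OF UnI1[OF UnI1[OF UnI1[OF UnI2]]]]) blast
next
  assume "1 \<le> j" "j < i" "i \<le> k"
  then show "(P i * T j, T j * P i) \<in> rook_rels k q"
    unfolding rook_rels_def Let_def P_def T_def
    by (intro UnI1[OF UnI1[OF UnI1[OF UnI2]]]) blast
next
  assume "1 \<le> j" "j < i" "i \<le> k"
  then show "(T j * P i, const q * P i) \<in> rook_rels k q"
    unfolding rook_rels_def Let_def P_def T_def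
    by (intro UnI1[OF UnI1[OF UnI2]]) blast
next
  assume "1 \<le> i" "i < k"
  then show "(P (i+1), const q * (P i * T i * P i - const (q - inverse q) * P i)) \<in> rook_rels k q"
    unfolding rook_rels_def Let_def P_def T_def
    by (intro UnI2) blast
qed

lemma A_to_rook_rels:
  assumes q: "q \<noteq> 0" and k: "1 \<le> k" and rel: "(l, r) \<in> A_rels k q"
  shows "two_sided_ideal.eqv (extended_ideal (rook_gens k) (rook_rels k q))
    (lift A_to_rook l) (lift A_to_rook r)"
proof -
  interpret presentation "rook_gens k" "rook_rels k q" by (rule presentation_rook)
  interpret hecke_scalar "extended_ideal (rook_gens k) (rook_rels k q)" "const q" "const (inverse q)"
      "const (q - inverse q)"
    by (rule hecke_scalar_free[OF q two_sided_ideal_axioms])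
  let ?P = "gen (RookP 1)" and ?T = "\<lambda>i. gen (RookT i)"
  have hecke: "lift A_to_rook l \<approx> lift A_to_rook r" if "(l, r) \<in> hecke_rels k q (\<lambda>i. gen (AT i))"
    using hecke_rels_lift[OF that, of A_to_rook]
    by (intro rel_eqv) (simp add: rook_rels_def Let_def)
  have PP: "?P * ?P \<approx> ?P"
    using k by (intro rel_eqv rook_rels_memI) auto
  then have idem: "(1 - ?P) * (1 - ?P) \<approx> 1 - ?P"
    by (simp add: eqv_def algebra_simps)
  have far: "(1 - ?P) * ?T j \<approx> ?T j * (1 - ?P)" if "2 \<le> j" "j < k" for j
  proof -
    have "?P * ?T j \<approx> ?T j * ?P"
      using that by (intro rel_eqv rook_rels_memI) auto
    from eqv_diff[OF eqv_refl[of "?T j"] this] show ?thesis by (simp add: algebra_simps)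
  qed
  have two: "(1 - ?P) * ?T 1 * (1 - ?P) * ?T 1 \<approx> ?T 1 * (1 - ?P) * ?T 1 * (1 - ?P) \<and>
      ?P * (?T 1 - const q) * ?P * (1 - ?T 1 * (1 - ?P) * ?T 1) \<approx> 0" if "2 \<le> k"
  proof -
    let ?F = "next_idem ?P (?T 1)" and ?P2 = "gen (RookP (1 + 1))"
    have quad: "?T 1 * ?T 1 \<approx> const (q - inverse q) * ?T 1 + 1"
      using that by (intro rel_eqv) (auto simp: rook_rels_def hecke_rels_def Let_def)
    have F: "?F \<approx> ?P2" unfolding next_idem_def
      using that by (intro eqv_sym[OF rel_eqv] rook_rels_memI) auto
    have c: "?P2 * ?T 1 \<approx> ?T 1 * ?P2" and e: "?T 1 * ?P2 \<approx> const q * ?P2"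
      using that by (intro rel_eqv rook_rels_memI; simp)+
    have "?F * ?T 1 \<approx> ?P2 * ?T 1" by (rule eqv_right[OF F])
    also note c
    finally have F2: "?F * ?T 1 \<approx> ?T 1 * ?P2" .
    also have "\<dots> \<approx> ?T 1 * ?F" by (rule eqv_left[OF eqv_sym[OF F]])
    finally have comm: "?F * ?T 1 \<approx> ?T 1 * ?F" .
    note F2
    also note e
    also have "const q * ?P2 \<approx> const q * ?F" by (rule eqv_left[OF eqv_sym[OF F]])
    finally have "?F * ?T 1 \<approx> const q * ?F" .
    then show ?thesis
      using complement_braid_iff_commute[OF quad, of ?P] quartic_iff_eigen[OF quad PP comm] comm by blast
  qed
  show ?thesis
    using rel idem far two unfolding A_rels_def Let_def Un_iff
    by (elim disjE) (auto simp: lift_hom hecke split: if_splits)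
qed

text \<open>
  Both sides satisfy the recursion (R5), and they agree for \<open>i = 1\<close> because
  \<open>1 - (1 - P\<^sub>1) = P\<^sub>1\<close>.
\<close>

lemma A_to_rook_A_idem:
  assumes q: "q \<noteq> 0" and i: "1 \<le> i" "i \<le> k"
  shows "two_sided_ideal.eqv (extended_ideal (rook_gens k) (rook_rels k q))
    (lift A_to_rook (A_idem q i)) (gen (RookP i))"
proof -
  interpret presentation "rook_gens k" "rook_rels k q" by (rule presentation_rook)
  interpret hecke_scalar "extended_ideal (rook_gens k) (rook_rels k q)" "const q" "const (inverse q)"
      "const (q - inverse q)"
    by (rule hecke_scalar_free[OF q two_sided_ideal_axioms])
  show ?thesis
    using i(1,2)
  proof (induction i rule: dec_induct)
    case base
    then show ?case by (simp add: lift_hom)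
  next
    case (step n)
    let ?P = "\<lambda>i. gen (RookP i)" and ?T = "gen (RookT n)"
    obtain m where n: "n = Suc m" using step by (cases n) auto
    have "lift A_to_rook (A_idem q (Suc n)) = next_idem (lift A_to_rook (A_idem q n)) ?T"
      by (simp add: n next_idem_def lift_hom)
    also have "\<dots> \<approx> next_idem (?P n) ?T"
      using step by (intro next_idem_cong) simp
    also have "\<dots> \<approx> ?P (Suc n)"
    proof -
      have "?P (n + 1) \<approx> next_idem (?P n) ?T" unfolding next_idem_def
        using step by (intro rel_eqv rook_rels_memI) auto
      then show ?thesis using eqv_sym by simp
    qed
    finally show ?case .
  qed
qed

theorem theorem1p10:
  fixes q :: complex and k :: nat
  assumes "q \<noteq> 0" and "k \<ge> 1"
  shows "(\<exists>\<phi>\<in>alg_iso (A_algebra k q) (rook_algebra k q).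
            (\<forall>i\<in>{1..<k}. \<phi> (A_T k q i) = rook_T k q i) \<and>
            \<phi> (A_X1 k q) =
              \<one>\<^bsub>rook_algebra k q\<^esub> \<ominus>\<^bsub>rook_algebra k q\<^esub> rook_P k q 1) \<and>
         is_presentation (A_gens k) (A_rels k q) (rook_algebra k q)
           (\<lambda>g. case g of
                  AX \<Rightarrow> \<one>\<^bsub>rook_algebra k q\<^esub> \<ominus>\<^bsub>rook_algebra k q\<^esub> rook_P k q 1
                | AT i \<Rightarrow> rook_T k q i)"
  (is "?iso \<and> is_presentation _ _ _ ?x")
proof -
  interpret A: presentation "A_gens k" "A_rels k q" by (rule presentation_A)
  interpret B: presentation "rook_gens k" "rook_rels k q" by (rule presentation_rook)
  have P1: "RookP 1 \<in> rook_gens k" using assms(2) by (simp add: rook_gens_def)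
  interpret inverse_substitutions "A_gens k" "A_rels k q" "rook_gens k" "rook_rels k q"
      A_to_rook "rook_to_A q"
  proof
    show "A_to_rook g \<in> carrier (free_algebra (rook_gens k))" if "g \<in> A_gens k" for g
      using that P1 by (auto simp: A_gens_def rook_gens_def intro!: free_closed)
    show "rook_to_A q h \<in> carrier (free_algebra (A_gens k))" if "h \<in> rook_gens k" for h
    proof (cases h)
      case (RookP i)
      then show ?thesis using that by (auto simp: rook_gens_def intro: A_idem_closed)
    next
      case (RookT i)
      then show ?thesis using that by (auto simp: rook_gens_def A_gens_def intro!: gen_closed)
    qed
    show "A.eqv (lift (rook_to_A q) (A_to_rook g)) (gen g)" for g
      by (cases g) (simp_all add: lift_hom)
    show "B.eqv (lift A_to_rook (rook_to_A q h)) (gen h)" if "h \<in> rook_gens k" for h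
    proof (cases h)
      case (RookP i)
      then show ?thesis using that A_to_rook_A_idem[OF assms(1), of i k] by (auto simp: rook_gens_def)
    qed simp
  qed (use assms rook_to_A_rels A_to_rook_rels in blast)+
  have "?x = (\<lambda>g. B.cls (A_to_rook g))"
  proof
    show "?x g = B.cls (A_to_rook g)" for g
      using B.cls_diff[of 1 "gen (RookP 1)"] P1
      by (cases g) (simp_all add: rook_T_def rook_P_def rook_algebra_def B.cls_one gen_closed)
  qed
  then have pres: "is_presentation (A_gens k) (A_rels k q) (rook_algebra k q) ?x"
    using is_presentation_substitution by (simp add: rook_algebra_def)
  moreover have "ring (rook_algebra k q)"
    unfolding rook_algebra_def by (rule ring_presented_algebra[OF B.wf])
  ultimately obtain \<phi> where "\<phi> \<in> alg_iso (A_algebra k q) (rook_algebra k q)"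
      "\<forall>g\<in>A_gens k. \<phi> (presented_class (A_gens k) (A_rels k q) (gen g)) = ?x g"
    using is_presentation_imp_iso[OF A.wf] unfolding A_algebra_def by blast
  then have ?iso
    by (intro bexI[of _ \<phi>]) (auto simp: A_T_def A_X1_def A_gens_def)
  then show ?thesis using pres by blast
qed

end
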